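(* The pushforward $\rho^{\mathrm{ev}}=(h_K)_*\mu_X$ of the normalized $G$-invariant probability measure $\mu_X$ on $X=\Gamma\backslash G$ under the spherical height map $h_K:X\to2\mathbb Z_{\ge0}$ is given by $$\rho^{\mathrm{ev}}(0)=\frac{q-1}{q},\qquad \rho^{\mathrm{ev}}(2m)=(q^2-1)q^{-2m-1}\qquad(m\ge1).$$
   Context: Let $q$ be a prime power, $F=\mathbb F_q((t^{-1}))$, $\mathcal O=\mathbb F_q[[t^{-1}]]$, $\pi=t^{-1}$, $G=\mathrm{SL}_2(F)$, $\Gamma=\mathrm{SL}_2(\mathbb F_q[t])$ (a lattice in $G$), $K=\mathrm{SL}_2(\mathcal O)$. $\mathcal T$ is the Bruhat--Tits tree of $\mathrm{PGL}_2(F)$: vertices are homothety classes $[L]$ of $\mathcal O$-lattices in $F^2$, adjacent if representatives can be chosen with $\pi L\subsetneq L'\subsetneq L$, $L/L'\simeq\mathbb F_q$. Put $v_0=[\mathcal O^2]$ and $v_n=[\mathrm{diag}(t^n,1)]v_0$. The quotient of $\mathcal T$ by $\mathrm{PGL}_2(\mathbb F_q[t])$ is a ray represented by $v_0-v_1-v_2-\cdots$, and the height $h(v)$ of a vertex $v$ is the $n\ge0$ for which $v$ lies in the $\mathrm{PGL}_2(\mathbb F_q[t])$-orbit of $v_n$. The spherical height map is $h_K(\Gamma g)=h(gv_0)$, where $g$ acts through its image in $\mathrm{PGL}_2(F)$; it takes even values. Equivalently, $G=\bigsqcup_{m\ge0}\Gamma a_mK$ with $a_m=\mathrm{diag}(t^m,t^{-m})$,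 and $h_K=2m$ on $\Gamma\backslash\Gamma a_mK$. *)

theory Defs
  imports
    "HOL-Probability.Probability"
    "HOL-Computational_Algebra.Formal_Laurent_Series"
    "HOL-Algebra.Coset"
begin

text \<open>
  The field \<open>\<F>\<^sub>q\<close> is a type \<open>'a::{field,finite}\<close> with \<open>q = CARD('a)\<close>. The local field
  \<open>F = \<F>\<^sub>q((t\<^sup>-\<^sup>1))\<close> is \<open>'a fls\<close>, whose formal variable \<^term>\<open>fls_X\<close> stands for the uniformizer
  \<open>\<pi> = t\<^sup>-\<^sup>1\<close>; thus \<open>t\<close> is \<^term>\<open>fls_X_inv\<close>. The library metric on \<open>'a fls\<close> is the \<open>\<pi>\<close>-adic one.
\<close>

definition int_ring :: "'a::{field,finite} fls set" where
  "int_ring = range fps_to_fls"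

definition poly_ring :: "'a::{field,finite} fls set" where
  "poly_ring = range (\<lambda>p::'a poly. poly (map_poly fls_const p) fls_X_inv)"

definition diag2 :: "'a::zero \<Rightarrow> 'a \<Rightarrow> 'a^2^2" where
  "diag2 a b = vector [vector [a, 0], vector [0, b]]"

definition SL2F :: "('a::{field,finite} fls^2^2) monoid" where
  "SL2F = \<lparr>carrier = {g. det g = 1}, mult = (**), one = mat 1\<rparr>"

definition SL2_poly :: "('a::{field,finite} fls^2^2) set" where
  "SL2_poly = {g. (\<forall>i j. g $ i $ j \<in> poly_ring) \<and> det g = 1}"

definition GL2_poly :: "('a::{field,finite} fls^2^2) set" where
  "GL2_poly = {g. (\<forall>i j. g $ i $ j \<in> poly_ring) \<and>
     (\<exists>h. (\<forall>i j. h $ i $ j \<in> poly_ring) \<and> g ** h = mat 1 \<and> h ** g = mat 1)}"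


section \<open>Vertices of the Bruhat--Tits tree and the height\<close>

definition is_lattice :: "('a::{field,finite} fls^2) set \<Rightarrow> bool" where
  "is_lattice L \<longleftrightarrow> (\<exists>u v. u \<noteq> v \<and> vec.independent {u, v} \<and>
     L = {a *s u + b *s v | a b. a \<in> int_ring \<and> b \<in> int_ring})"

definition homothety_class :: "('a::{field,finite} fls^2) set \<Rightarrow> ('a fls^2) set set" where
  "homothety_class L = {(\<lambda>x. c *s x) ` L | c. c \<noteq> 0}"

definition tree_vertices :: "('a::{field,finite} fls^2) set set set" where
  "tree_vertices = {homothety_class L | L. is_lattice L}"

text \<open>
  Scalar matrices act trivially on homothety classes, so the action of \<open>PGL\<^sub>2\<close> on vertices is given
  by that of \<open>GL\<^sub>2\<close>, and \<open>PGL\<^sub>2(\<F>\<^sub>q[t])\<close>-orbits are \<^const>\<open>GL2_poly\<close>-orbits.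
\<close>

definition vertex_act :: "'a::{field,finite} fls^2^2 \<Rightarrow> ('a fls^2) set set \<Rightarrow> ('a fls^2) set set" where
  "vertex_act g v = (\<lambda>L. (\<lambda>x. g *v x) ` L) ` v"

definition base_vertex :: "('a::{field,finite} fls^2) set set" where
  "base_vertex = homothety_class {x. \<forall>i. x $ i \<in> int_ring}"

definition ray_vertex :: "nat \<Rightarrow> ('a::{field,finite} fls^2) set set" where
  "ray_vertex n = vertex_act (diag2 (fls_X_inv ^ n) 1) base_vertex"

lemma is_lattice_matrix_image:
  assumes "invertible g" and "is_lattice L"
  shows "is_lattice ((\<lambda>x. g *v x) ` L)"
proof -
  obtain u v where uv: "u \<noteq> v" "vec.independent {u, v}"
    and L: "L = {a *s u + b *s v | a b. a \<in> int_ring \<and> b \<in> int_ring}"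
    using assms(2) unfolding is_lattice_def by blast
  have inj: "inj ((*v) g)"
    using assms(1) by (simp add: inj_matrix_vector_mult)
  have "vec.independent ((*v) g ` {u, v})"
    using uv(2) inj by (intro vec.linear_independent_injective_image)
      (auto simp: matrix_vector_mul_linear_gen intro: inj_on_subset[OF inj])
  moreover have "g *v u \<noteq> g *v v"
    using inj uv(1) by (auto dest: injD)
  moreover have "(\<lambda>x. g *v x) ` L =
      {a *s (g *v u) + b *s (g *v v) | a b. a \<in> int_ring \<and> b \<in> int_ring}"
    unfolding L by (auto simp: vec.add vec.scale image_iff) (metis vec.add vec.scale)+
  ultimately show ?thesis
    unfolding is_lattice_def by (intro exI[of _ "g *v u"] exI[of _ "g *v v"]) auto
qed

lemma vertex_act_homothety_class:
  "vertex_act g (homothety_class L) = homothety_class ((\<lambda>x. g *v x) ` L)"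
proof -
  have "homothety_class L = (\<lambda>c. (\<lambda>x. c *s x) ` L) ` {c. c \<noteq> 0}" for L :: "('a fls^2) set"
    unfolding homothety_class_def by auto
  then show ?thesis
    by (simp add: vertex_act_def image_image vec.scale)
qed

lemma vertex_act_in_tree_vertices:
  assumes "invertible g" and "v \<in> tree_vertices"
  shows "vertex_act g v \<in> tree_vertices"
  using assms is_lattice_matrix_image[OF assms(1)]
  unfolding tree_vertices_def by (force simp: vertex_act_homothety_class)

lemma base_vertex_in_tree_vertices: "base_vertex \<in> tree_vertices"
proof -
  let ?u = "axis 1 1 :: 'a fls^2" and ?v = "axis 2 1 :: 'a fls^2"
  have "vec.independent (cart_basis :: ('a fls^2) set)"
    by (rule independent_cart_basis)
  moreover have "{?u, ?v} \<subseteq> cart_basis"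
    by (auto simp: cart_basis_def)
  ultimately have "vec.independent {?u, ?v}"
    by (rule vec.independent_mono)
  moreover have "?u \<noteq> ?v"
    by (simp add: axis_eq_axis)
  moreover have "{x. \<forall>i. x $ i \<in> int_ring} =
      {a *s ?u + b *s ?v | a b. a \<in> int_ring \<and> b \<in> int_ring}" (is "?A = ?B")
  proof
    show "?A \<subseteq> ?B"
    proof
      fix x assume "x \<in> ?A"
      moreover have "x = (x $ 1) *s ?u + (x $ 2) *s ?v"
        by (simp add: vec_eq_iff forall_2 axis_def)
      ultimately show "x \<in> ?B" by blast
    qed
    show "?B \<subseteq> ?A"
      by (auto simp: forall_2 axis_def)
  qed
  ultimately show ?thesis
    unfolding base_vertex_def tree_vertices_def is_lattice_def by blast
qed

definition height :: "('a::{field,finite} fls^2) set set \<Rightarrow> nat" where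
  "height v = (THE n. \<exists>g \<in> GL2_poly. v = vertex_act g (ray_vertex n))"


section \<open>The space \<open>\<Gamma>\<backslash>G\<close>, its invariant probability measure, and the spherical height\<close>

definition quot_X :: "('a::{field,finite} fls^2^2) set set" where
  "quot_X = rcosets\<^bsub>SL2F\<^esub> SL2_poly"

text \<open>The Borel \<open>\<sigma>\<close>-algebra of the quotient topology on \<^const>\<open>quot_X\<close>.\<close>

definition borel_X :: "('a::{field,finite} fls^2^2) set measure" where
  "borel_X = sigma quot_X
     {U. U \<subseteq> quot_X \<and>
         openin (top_of_set (carrier SL2F)) {g \<in> carrier SL2F. SL2_poly #>\<^bsub>SL2F\<^esub> g \<in> U}}"

definition invariant_prob_X :: "('a::{field,finite} fls^2^2) set measure \<Rightarrow> bool" where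
  "invariant_prob_X \<mu> \<longleftrightarrow> prob_space \<mu> \<and> sets \<mu> = sets borel_X \<and>
     (\<forall>g \<in> carrier SL2F. distr \<mu> borel_X (\<lambda>x. x #>\<^bsub>SL2F\<^esub> g) = \<mu>)"

text \<open>
  The height of \<open>g v\<^sub>0\<close> is the same for all \<open>g\<close> in one coset, so the image below is a singleton.
\<close>

definition spherical_height :: "('a::{field,finite} fls^2^2) set \<Rightarrow> nat" where
  "spherical_height x = the_elem ((\<lambda>g. height (vertex_act g base_vertex)) ` x)"

definition rho_ev :: "('a::{field,finite} fls^2^2) set measure \<Rightarrow> nat measure" where
  "rho_ev \<mu> = distr \<mu> (count_space {n. even n}) spherical_height"

end

theory Submission
  imports Defs
begin

text \<open>
  The height of \<open>g v\<^sub>0\<close> is \<open>2 m\<close> exactly when the shortest nonzero vectors of the row lattice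
  \<open>\<F>\<^sub>q[t]\<^sup>2 g\<close> have norm \<open>q\<^sup>-\<^sup>m\<close> (lemma \<open>height_eq_iff\<close>). This follows from the decomposition
  \<open>G = \<Union> \<Gamma> a\<^sub>m K\<close> (lemma \<open>cartan_decomposition\<close>) and from invariants of lattices that determine the
  height. The row lattice depends on the coset \<open>\<Gamma>g\<close> only, and \<open>G\<close> acts on it from the right, so the
  invariance of the measure allows the masses of the level sets to be compared by moving short
  vectors with elements of \<open>G\<close>.

  Let \<open>Y\<^sub>m\<close> be the set of cosets of height \<open>2 m\<close>, and let \<open>P\<^sub>m(e)\<close> be the part of \<open>Y\<^sub>m\<close> where a shortest
  vector \<open>(w\<^sub>1, w\<^sub>2)\<close> satisfies \<open>\<bar>w\<^sub>1\<bar> = q\<^sup>-\<^sup>m\<close> and \<open>\<bar>w\<^sub>2\<bar> \<le> q\<^sup>-\<^sup>m\<^sup>-\<^sup>e\<close>. Four relations hold.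

  \<^item> The diagonal matrix \<open>diag(\<pi>, \<pi>\<^sup>-\<^sup>1)\<close> maps \<open>P\<^sub>m(2)\<close> onto \<open>P\<^bsub>m+1\<^esub>(0)\<close> (lemma \<open>aligned_climb\<close>).
  \<^item> If \<open>2 m + e \<ge> 1\<close>, the unipotent matrices with entry \<open>c \<pi>\<^sup>e\<close>, where \<open>c\<close> runs through \<open>\<F>\<^sub>q\<close>, cut
    \<open>P\<^sub>m(e)\<close> into \<open>q\<close> translates of \<open>P\<^sub>m(e+1)\<close> (lemmas \<open>aligned_iff_ex_digit\<close>, \<open>aligned_digit_unique\<close>).
  \<^item> \<open>Y\<^sub>0 = P\<^sub>0(1)\<close>, because all directions modulo \<open>\<pi>\<close> occur at height \<open>0\<close> (lemma \<open>level_0_iff_aligned\<close>).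
  \<^item> For \<open>m \<ge> 1\<close>, \<open>Y\<^sub>m\<close> is the disjoint union of \<open>P\<^sub>m(0)\<close> and a translate of \<open>P\<^sub>m(1)\<close>
    (lemmas \<open>level_iff_aligned\<close>, \<open>aligned_weyl_disjoint\<close>).

  The disjointness claims rest on one observation: the determinant of two vectors of the row lattice
  is a polynomial in \<open>t\<close>, so it vanishes as soon as it has norm less than \<open>1\<close>
  (lemma \<open>cross2_poly_rows_eq_0\<close>).

  With \<open>p = \<mu>(P\<^sub>1(0))\<close>, the relations give \<open>\<mu>(Y\<^sub>0) = q p\<close> and \<open>\<mu>(Y\<^sub>m) = (1 + 1/q) q\<^bsup>-2(m-1)\<^esup> p\<close> for
  \<open>m \<ge> 1\<close>. The masses sum to \<open>1\<close>, which determines \<open>p\<close>.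
\<close>

no_notation fps_nth (infixl \<open>$\<close> 75)

section \<open>Fractional ideals and polynomials in the field of Laurent series\<close>

text \<open>
  The fractional ideals \<open>\<pi>\<^sup>n \<O>\<close>. Membership replaces bounds on the valuation, because
  \<^const>\<open>fls_subdegree\<close> assigns the value \<open>0\<close> to the zero series.
\<close>

definition pideal :: "int \<Rightarrow> 'a::{field,finite} fls set" where
  "pideal n = {f. \<forall>k<n. fls_nth f k = 0}"

lemma pideal_iff_subdegree: "f \<in> pideal n \<longleftrightarrow> f = 0 \<or> n \<le> fls_subdegree f"
  unfolding pideal_def by (auto intro: fls_subdegree_geI)

lemma zero_in_pideal [simp]: "0 \<in> pideal n"
  by (simp add: pideal_def)

lemma pideal_add: "f \<in> pideal n \<Longrightarrow> g \<in> pideal n \<Longrightarrow> f + g \<in> pideal n"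
  by (simp add: pideal_def)

lemma pideal_diff: "f \<in> pideal n \<Longrightarrow> g \<in> pideal n \<Longrightarrow> f - g \<in> pideal n"
  by (simp add: pideal_def)

lemma pideal_uminus [simp]: "- f \<in> pideal n \<longleftrightarrow> f \<in> pideal n"
  by (simp add: pideal_def)

lemma pideal_antimono: "f \<in> pideal n \<Longrightarrow> m \<le> n \<Longrightarrow> f \<in> pideal m"
  by (simp add: pideal_def)

lemma pideal_mult: "f \<in> pideal m \<Longrightarrow> g \<in> pideal n \<Longrightarrow> f * g \<in> pideal (m + n)"
  by (cases "f = 0 \<or> g = 0") (auto simp: pideal_iff_subdegree)

lemma pideal_succ_iff: "f \<in> pideal (n + 1) \<longleftrightarrow> f \<in> pideal n \<and> fls_nth f n = 0"
  by (force simp: pideal_def)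

lemma pideal_mult_nth:
  assumes "f \<in> pideal m" "g \<in> pideal n"
  shows "fls_nth (f * g) (m + n) = fls_nth f m * fls_nth g n"
proof -
  consider "f = 0 \<or> g = 0" | "fls_subdegree f = m" "fls_subdegree g = n"
    | "f \<noteq> 0" "g \<noteq> 0" "m < fls_subdegree f \<or> n < fls_subdegree g"
    using assms by (force simp: pideal_iff_subdegree)
  then show ?thesis
  proof cases
    case 2
    then show ?thesis by (metis fls_times_base)
  next
    case 3
    then have "m + n < fls_subdegree f + fls_subdegree g"
      using assms by (auto simp: pideal_iff_subdegree)
    moreover have "fls_nth f m = 0 \<or> fls_nth g n = 0" using 3 by auto
    ultimately show ?thesis by (simp add: fls_times_nth_eq0)
  qed auto
qed

lemma in_some_pideal: "\<exists>n. f \<in> pideal n"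
  using pideal_iff_subdegree by blast

lemma one_in_pideal [simp]: "1 \<in> pideal n \<longleftrightarrow> n \<le> 0"
  by (auto simp: pideal_iff_subdegree)

lemma fls_const_in_pideal [simp]: "n \<le> 0 \<Longrightarrow> fls_const c \<in> pideal n"
  by (auto simp: pideal_def)

lemma shift_in_pideal_iff [simp]: "fls_shift j f \<in> pideal n \<longleftrightarrow> f \<in> pideal (n + j)"
proof -
  have "(\<forall>k<n. fls_nth f (k + j) = 0) \<longleftrightarrow> (\<forall>k<n + j. fls_nth f k = 0)"
    by (metis add_less_cancel_right diff_add_cancel)
  then show ?thesis by (simp add: pideal_def)
qed

lemma int_ring_eq_pideal: "int_ring = pideal 0"
proof -
  have "f \<in> range fps_to_fls" if "f \<in> pideal 0" for f :: "'a fls"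
  proof -
    have "f = fps_to_fls (fls_regpart f)"
      using that by (cases "f = 0") (auto simp: pideal_iff_subdegree)
    then show ?thesis by (rule range_eqI)
  qed
  then show ?thesis
    by (auto simp: int_ring_def pideal_def)
qed

definition poly_to_fls :: "'a::{field,finite} poly \<Rightarrow> 'a fls" where
  "poly_to_fls p = poly (map_poly fls_const p) fls_X_inv"

lemma poly_to_fls_nth: "fls_nth (poly_to_fls p) k = (if k \<le> 0 then coeff p (nat (- k)) else 0)"
proof -
  have d: "degree (map_poly fls_const p) = degree p"
    by (rule degree_map_poly) auto
  have "fls_nth (poly_to_fls p) k =
      (\<Sum>i\<le>degree p. fls_nth (fls_const (coeff p i) * fls_X_inv ^ i) k)"
    by (simp add: poly_to_fls_def poly_altdef d coeff_map_poly fls_nth_sum)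
  also have "\<dots> = (\<Sum>i\<le>degree p. if k = - int i then coeff p i else 0)"
    by (intro sum.cong) auto
  also have "\<dots> = (\<Sum>i\<le>degree p. if i = nat (-k) then (if k \<le> 0 then coeff p i else 0) else 0)"
    by (intro sum.cong) auto
  also have "\<dots> = (if k \<le> 0 then coeff p (nat (- k)) else 0)"
    by (auto simp: coeff_eq_0)
  finally show ?thesis .
qed

lemma poly_ring_iff: "f \<in> poly_ring \<longleftrightarrow> (\<forall>k>0. fls_nth f k = 0)"
proof
  assume "f \<in> poly_ring"
  then show "\<forall>k>0. fls_nth f k = 0"
    by (auto simp: poly_ring_def poly_to_fls_nth simp flip: poly_to_fls_def)
next
  assume f: "\<forall>k>0. fls_nth f k = 0"
  define N where "N = nat (- fls_subdegree f)"
  have fin: "\<forall>i>N. fls_nth f (- int i) = 0"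
    by (auto simp: N_def)
  then have "coeff (Abs_poly (\<lambda>i. fls_nth f (- int i))) = (\<lambda>i. fls_nth f (- int i))"
    by (intro coeff_Abs_poly[of N]) auto
  then have "f = poly_to_fls (Abs_poly (\<lambda>i. fls_nth f (- int i)))"
    using f by (intro fls_eqI) (auto simp: poly_to_fls_nth)
  then show "f \<in> poly_ring"
    by (auto simp: poly_ring_def poly_to_fls_def)
qed

lemma poly_ring_add: "f \<in> poly_ring \<Longrightarrow> g \<in> poly_ring \<Longrightarrow> f + g \<in> poly_ring"
  by (simp add: poly_ring_iff)

lemma poly_ring_diff: "f \<in> poly_ring \<Longrightarrow> g \<in> poly_ring \<Longrightarrow> f - g \<in> poly_ring"
  by (simp add: poly_ring_iff)

lemma poly_ring_uminus [simp]: "- f \<in> poly_ring \<longleftrightarrow> f \<in> poly_ring"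
  by (simp add: poly_ring_iff)

lemma fls_const_in_poly_ring [simp]: "fls_const c \<in> poly_ring"
  by (simp add: poly_ring_iff)

lemma zero_one_in_poly_ring [simp]: "0 \<in> poly_ring" "1 \<in> poly_ring"
  by (simp_all add: poly_ring_iff)

lemma poly_ring_mult:
  assumes "f \<in> poly_ring" "g \<in> poly_ring"
  shows "f * g \<in> poly_ring"
proof -
  obtain p r where "f = poly_to_fls p" "g = poly_to_fls r"
    using assms by (auto simp: poly_ring_def poly_to_fls_def)
  moreover have "poly_to_fls p * poly_to_fls r = poly_to_fls (p * r)"
  proof -
    have "map_poly fls_const (p * r) = map_poly fls_const p * map_poly fls_const r"
      by (rule poly_eqI, rule fls_eqI) (simp add: coeff_map_poly coeff_mult fls_nth_sum)
    then show ?thesis by (simp add: poly_to_fls_def)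
  qed
  ultimately show ?thesis by (auto simp: poly_ring_def poly_to_fls_def)
qed

text \<open>
  Discreteness of \<open>\<F>\<^sub>q[t]\<close> in \<open>F\<close>: a polynomial in \<open>t\<close> has no terms with a positive power
  of \<open>\<pi>\<close>.
\<close>

lemma poly_ring_inter_pideal:
  assumes "f \<in> poly_ring" "f \<in> pideal n" "n \<ge> 1"
  shows "f = 0"
proof (rule fls_eqI)
  fix k show "fls_nth f k = fls_nth 0 k"
    using assms by (cases "k > 0") (auto simp: poly_ring_iff pideal_def)
qed

lemma poly_ring_plus_pideal: "\<exists>p \<in> poly_ring. f - p \<in> pideal 1"
proof -
  let ?p = "f - fls_shift (-1) (fps_to_fls (fls_regpart (fls_shift 1 f)))"
  have "?p \<in> poly_ring" by (auto simp: poly_ring_iff)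
  moreover have "f - ?p \<in> pideal 1" by (simp add: pideal_def)
  ultimately show ?thesis by blast
qed

section \<open>Two-by-two matrices and the arithmetic groups\<close>

lemma row_mult_nth: "(v v* (M :: 'b::comm_semiring_1^2^2)) $ j = v $ 1 * M $ 1 $ j + v $ 2 * M $ 2 $ j"
  by (simp add: vector_matrix_mult_def sum_2 mult.commute)

lemma mat_mult_nth: "((M :: 'b::comm_semiring_1^2^2) ** N) $ i $ j = M $ i $ 1 * N $ 1 $ j + M $ i $ 2 * N $ 2 $ j"
  by (simp add: matrix_matrix_mult_def sum_2)

lemma mat_vec_nth: "((M :: 'b::comm_semiring_1^2^2) *v x) $ i = M $ i $ 1 * x $ 1 + M $ i $ 2 * x $ 2"
  by (simp add: matrix_vector_mult_def sum_2)

definition mat2 :: "'b \<Rightarrow> 'b \<Rightarrow> 'b \<Rightarrow> 'b \<Rightarrow> ('b::zero)^2^2" where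
  "mat2 a b c d = vector [vector [a, b], vector [c, d]]"

lemma mat2_nth [simp]:
  "mat2 a b c d $ 1 $ 1 = a" "mat2 a b c d $ 1 $ 2 = b"
  "mat2 a b c d $ 2 $ 1 = c" "mat2 a b c d $ 2 $ 2 = d"
  by (simp_all add: mat2_def)

lemma mat2_eqI:
  assumes "M $ 1 $ 1 = N $ 1 $ 1" "M $ 1 $ 2 = N $ 1 $ 2" "M $ 2 $ 1 = N $ 2 $ 1" "M $ 2 $ 2 = N $ 2 $ 2"
  shows "M = (N :: 'b^2^2)"
  using assms by (simp add: vec_eq_iff forall_2)

definition adj2 :: "'b::comm_ring_1^2^2 \<Rightarrow> 'b^2^2" where
  "adj2 M = mat2 (M $ 2 $ 2) (- M $ 1 $ 2) (- M $ 2 $ 1) (M $ 1 $ 1)"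

lemma adj2_mult:
  assumes "det (M :: 'b::comm_ring_1^2^2) = 1"
  shows "adj2 M ** M = mat 1" "M ** adj2 M = mat 1"
  using assms
  by (auto intro!: mat2_eqI simp: adj2_def mat_mult_nth mat_def det_2 algebra_simps)

lemma det_adj2: "det (adj2 M) = det (M :: 'b::comm_ring_1^2^2)"
  by (simp add: det_2 adj2_def algebra_simps)

definition cross2 :: "'b::comm_ring_1^2 \<Rightarrow> 'b^2 \<Rightarrow> 'b" where
  "cross2 v w = v $ 1 * w $ 2 - v $ 2 * w $ 1"

lemma cross2_row_mult: "cross2 (v v* M) (w v* M) = cross2 v w * det M"
  by (simp add: cross2_def det_2 row_mult_nth algebra_simps)

lemma SL2_poly_mult: "g \<in> SL2_poly \<Longrightarrow> h \<in> SL2_poly \<Longrightarrow> g ** h \<in> SL2_poly"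
  by (auto simp: SL2_poly_def det_mul mat_mult_nth intro!: poly_ring_add poly_ring_mult)

lemma SL2_poly_adj2: "g \<in> SL2_poly \<Longrightarrow> adj2 g \<in> SL2_poly"
  by (auto simp: SL2_poly_def det_adj2 forall_2 adj2_def det_2 algebra_simps)

lemma mat_1_in_SL2_poly: "mat 1 \<in> SL2_poly"
  by (simp add: SL2_poly_def mat_def det_2)

lemma SL2_poly_subset_GL2_poly: "SL2_poly \<subseteq> GL2_poly"
proof
  fix g :: "'a fls^2^2" assume g: "g \<in> SL2_poly"
  then have "adj2 g \<in> SL2_poly" "det g = 1" by (simp_all add: SL2_poly_adj2) (simp add: SL2_poly_def)
  with g show "g \<in> GL2_poly"
    using adj2_mult[of g] unfolding GL2_poly_def SL2_poly_def by blast
qed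

section \<open>Short vectors of the row lattice\<close>

definition vec_pideal :: "int \<Rightarrow> ('a::{field,finite} fls^2) set" where
  "vec_pideal n = {w. w $ 1 \<in> pideal n \<and> w $ 2 \<in> pideal n}"

definition poly_rows :: "('a::{field,finite} fls^2) set" where
  "poly_rows = {v. v \<noteq> 0 \<and> v $ 1 \<in> poly_ring \<and> v $ 2 \<in> poly_ring}"

text \<open>
  For \<open>g\<close> in \<open>SL\<^sub>2(F)\<close> the nonzero vectors of the row lattice \<open>\<F>\<^sub>q[t]\<^sup>2 g\<close> depend on \<open>\<Gamma>g\<close>
  only, so any condition asking such a vector to lie in a set \<open>W\<close> descends to \<open>\<Gamma>\<backslash>G\<close>.
\<close>

definition hits :: "('a::{field,finite} fls^2) set \<Rightarrow> 'a fls^2^2 \<Rightarrow> bool" where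
  "hits W g \<longleftrightarrow> (\<exists>v\<in>poly_rows. v v* g \<in> W)"

definition int_mats :: "('a::{field,finite} fls^2^2) set" where
  "int_mats = {k. \<forall>i j. k $ i $ j \<in> pideal 0}"

definition SL2_int :: "('a::{field,finite} fls^2^2) set" where
  "SL2_int = {k \<in> int_mats. det k = 1}"

lemma vec_2_eq_0_iff: "(v :: 'b::zero^2) = 0 \<longleftrightarrow> v $ 1 = 0 \<and> v $ 2 = 0"
  by (simp add: vec_eq_iff forall_2)

lemma row_of_mult: "((A :: 'b::comm_semiring_1^2^2) ** (B :: 'b^2^2)) $ i = A $ i v* B"
  by (simp add: vec_eq_iff mat_mult_nth row_mult_nth)

lemma vec_pideal_antimono: "w \<in> vec_pideal n \<Longrightarrow> m \<le> n \<Longrightarrow> w \<in> vec_pideal m"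
  by (auto simp: vec_pideal_def intro: pideal_antimono)

lemma vec_pideal_int_mats:
  assumes "w \<in> vec_pideal n" "k \<in> int_mats"
  shows "w v* k \<in> vec_pideal n"
proof -
  have "w $ i * k $ i $ j \<in> pideal n" if "i = 1 \<or> i = 2" for i j
    using that assms pideal_mult[of "w $ i" n "k $ i $ j" 0]
    by (auto simp: vec_pideal_def int_mats_def)
  then show ?thesis
    by (auto simp: vec_pideal_def row_mult_nth intro!: pideal_add)
qed

lemma matrix_pideal_bound: "\<exists>c. \<forall>i j. (M :: 'a::{field,finite} fls^2^2) $ i $ j \<in> pideal c"
proof -
  define c where "c i j = (SOME n. M $ i $ j \<in> pideal n)" for i j
  have c: "M $ i $ j \<in> pideal (c i j)" for i j
    unfolding c_def by (rule someI_ex) (rule in_some_pideal)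
  have "M $ i $ j \<in> pideal (Min (range (\<lambda>(i, j). c i j)))" for i j
    by (rule pideal_antimono[OF c], rule Min_le) auto
  then show ?thesis by blast
qed

lemma row_mult_pideal_bound: "\<exists>c. \<forall>w n. w \<in> vec_pideal n \<longrightarrow> w v* M \<in> vec_pideal (n + c)"
proof -
  obtain c where "\<forall>i j. M $ i $ j \<in> pideal c" using matrix_pideal_bound by blast
  then show ?thesis
    by (intro exI[of _ c]) (auto simp: vec_pideal_def row_mult_nth intro!: pideal_add pideal_mult)
qed

lemma int_mats_mult: "k \<in> int_mats \<Longrightarrow> l \<in> int_mats \<Longrightarrow> k ** l \<in> int_mats"
proof -
  assume "k \<in> int_mats" "l \<in> int_mats"
  then have "k $ i $ j * l $ j $ i' \<in> pideal 0" for i j i'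
    using pideal_mult[of "k $ i $ j" 0 "l $ j $ i'" 0] by (auto simp: int_mats_def)
  then show ?thesis
    by (auto simp: int_mats_def mat_mult_nth intro!: pideal_add)
qed

lemma int_mats_det: "k \<in> int_mats \<Longrightarrow> det k \<in> pideal 0"
proof -
  assume "k \<in> int_mats"
  then have "k $ i $ j * k $ i' $ j' \<in> pideal 0" for i j i' j'
    using pideal_mult[of "k $ i $ j" 0 "k $ i' $ j'" 0] by (simp add: int_mats_def)
  then show ?thesis by (simp add: det_2 pideal_diff)
qed

lemma SL2_int_mult: "k \<in> SL2_int \<Longrightarrow> l \<in> SL2_int \<Longrightarrow> k ** l \<in> SL2_int"
  by (simp add: SL2_int_def int_mats_mult det_mul)

lemma SL2_int_adj2: "k \<in> SL2_int \<Longrightarrow> adj2 k \<in> SL2_int"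
  unfolding SL2_int_def int_mats_def
  by (auto simp: det_adj2 forall_2) (auto simp: adj2_def)

lemma mat2_in_SL2_int:
  "a \<in> pideal 0 \<Longrightarrow> b \<in> pideal 0 \<Longrightarrow> c \<in> pideal 0 \<Longrightarrow> d \<in> pideal 0 \<Longrightarrow> a * d - b * c = 1
   \<Longrightarrow> mat2 a b c d \<in> SL2_int"
  by (simp add: SL2_int_def int_mats_def forall_2 det_2)

lemma mat2_in_SL2_poly:
  "a \<in> poly_ring \<Longrightarrow> b \<in> poly_ring \<Longrightarrow> c \<in> poly_ring \<Longrightarrow> d \<in> poly_ring \<Longrightarrow> a * d - b * c = 1
   \<Longrightarrow> mat2 a b c d \<in> SL2_poly"
  by (simp add: SL2_poly_def forall_2 det_2)

lemma poly_rows_mult_GL2: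
  assumes "v \<in> poly_rows" "g \<in> GL2_poly"
  shows "v v* g \<in> poly_rows"
proof -
  obtain h where "g ** h = mat 1" using assms(2) by (auto simp: GL2_poly_def)
  then have "(v v* g) v* h = v" by (simp add: vector_matrix_mul_assoc)
  then have "v v* g \<noteq> 0" using assms(1) by (auto simp: poly_rows_def)
  then show ?thesis
    using assms by (auto simp: poly_rows_def GL2_poly_def row_mult_nth intro!: poly_ring_add poly_ring_mult)
qed

lemma hits_GL2_poly_iff:
  assumes "g \<in> GL2_poly"
  shows "hits W (g ** M) \<longleftrightarrow> hits W M"
proof -
  obtain h where h: "h \<in> GL2_poly" "h ** g = mat 1"
    using assms unfolding GL2_poly_def by blast
  have *: "hits W M" if "hits W (g ** M)" "g \<in> GL2_poly" for g M
    using that poly_rows_mult_GL2 unfolding hits_def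
    by (metis vector_matrix_mul_assoc)
  have "M = h ** (g ** M)" by (simp add: matrix_mul_assoc h)
  with *[of g M] *[of h "g ** M"] assms h(1) show ?thesis by metis
qed

lemma hits_int_mats:
  "hits (vec_pideal n) M \<Longrightarrow> k \<in> int_mats \<Longrightarrow> hits (vec_pideal n) (M ** k)"
  unfolding hits_def by (metis vec_pideal_int_mats vector_matrix_mul_assoc)

lemma hits_SL2_int_iff:
  assumes "k \<in> SL2_int"
  shows "hits (vec_pideal n) (M ** k) \<longleftrightarrow> hits (vec_pideal n) M"
proof
  assume "hits (vec_pideal n) (M ** k)"
  then have "hits (vec_pideal n) ((M ** k) ** adj2 k)"
    using SL2_int_adj2[OF assms] hits_int_mats by (auto simp: SL2_int_def)
  then show "hits (vec_pideal n) M"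
    using assms adj2_mult[of k] by (simp add: SL2_int_def flip: matrix_mul_assoc)
qed (use assms in \<open>auto simp: SL2_int_def intro: hits_int_mats\<close>)

text \<open>
  The row lattice is discrete: a row \<open>v g\<close> in a deep ideal would give a polynomial row \<open>v\<close> whose
  entries lie in \<open>\<pi> \<O>\<close>.
\<close>

lemma hits_vec_pideal_bounded:
  assumes "det g = 1"
  shows "\<exists>n. \<not> hits (vec_pideal n) g"
proof -
  obtain c where c: "\<And>w n. w \<in> vec_pideal n \<Longrightarrow> w v* adj2 g \<in> vec_pideal (n + c)"
    using row_mult_pideal_bound[of "adj2 g"] by blast
  have "False" if "v \<in> poly_rows" "v v* g \<in> vec_pideal (1 - c)" for v
  proof -
    have "v = (v v* g) v* adj2 g"
      using adj2_mult[OF assms] by (simp add: vector_matrix_mul_assoc)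
    then have "v \<in> vec_pideal 1" using c[OF that(2)] by simp
    then have "v = 0"
      using that(1) poly_ring_inter_pideal by (auto simp: vec_pideal_def poly_rows_def vec_2_eq_0_iff)
    then show False using that(1) by (simp add: poly_rows_def)
  qed
  then show ?thesis unfolding hits_def by blast
qed

lemma SL2_poly_row_in_poly_rows:
  "g \<in> SL2_poly \<Longrightarrow> g $ i \<in> poly_rows"
  using exhaust_2[of i]
  by (auto simp: SL2_poly_def poly_rows_def det_2)

section \<open>The decomposition into double cosets\<close>

definition cartan :: "int \<Rightarrow> 'a::{field,finite} fls^2^2" where
  "cartan m = mat2 (fls_X_intpow (- m)) 0 0 (fls_X_intpow m)"

lemma shift_one_mult: "fls_shift n 1 * (f :: 'b::semiring_1 fls) = fls_shift n f" "f * fls_shift n 1 = fls_shift n f"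
  using fls_X_intpow_times_conv_shift[where i = "- n" and f = f] by simp_all

lemma det_cartan: "det (cartan m) = 1"
  by (simp add: cartan_def det_2 shift_one_mult)

text \<open>
  Up to the factor \<open>\<pi>\<^sup>n\<close> the row has a unit entry in the local ring \<open>\<O>\<close>, so it is a row of a matrix in
  \<open>SL\<^sub>2(\<O>)\<close>, and the inverse of that matrix moves it to a multiple of a basis row.
\<close>

lemma unimodular_over_int_ring:
  assumes "w \<in> vec_pideal n" "fls_nth (w $ 1) n \<noteq> 0 \<or> fls_nth (w $ 2) n \<noteq> 0"
  shows "\<exists>k\<in>SL2_int. w v* k = vector [0, fls_X_intpow n]"
proof -
  define x where "x = fls_shift n (w $ 1)"
  define y where "y = fls_shift n (w $ 2)"
  have xy: "x \<in> pideal 0" "y \<in> pideal 0" "fls_nth x 0 \<noteq> 0 \<or> fls_nth y 0 \<noteq> 0"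
    using assms by (auto simp: x_def y_def vec_pideal_def)
  have w: "w $ 1 = fls_X_intpow n * x" "w $ 2 = fls_X_intpow n * y"
    by (simp_all add: x_def y_def shift_one_mult)
  have inv: "\<exists>z\<in>pideal 0. f * z = 1" if "f \<in> pideal 0" "fls_nth f 0 \<noteq> 0" for f :: "'a fls"
  proof
    have "f \<noteq> 0" using that by auto
    moreover have "fls_subdegree f = 0"
      using that by (intro fls_subdegree_eqI) (auto simp: pideal_def)
    ultimately show "inverse f \<in> pideal 0" "f * inverse f = 1"
      by (simp_all add: pideal_iff_subdegree fls_inverse_subdegree)
  qed
  obtain r s where rs: "r \<in> pideal 0" "s \<in> pideal 0" "x * r + y * s = 1"
  proof (cases "fls_nth x 0 = 0")
    case True
    with xy inv[of y] obtain z where "z \<in> pideal 0" "y * z = 1" by auto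
    then show ?thesis by (intro that[of 0 z]) auto
  next
    case False
    with xy inv[of x] obtain z where "z \<in> pideal 0" "x * z = 1" by auto
    then show ?thesis by (intro that[of z 0]) auto
  qed
  \<comment> \<open>The first column is orthogonal to \<open>(x, y)\<close>, and the Bezout relation gives determinant \<open>1\<close>.\<close>
  have "mat2 y r (- x) s \<in> SL2_int"
    using rs xy by (intro mat2_in_SL2_int) (auto simp: algebra_simps)
  moreover have "w v* mat2 y r (- x) s = vector [0, fls_X_intpow n]"
  proof -
    have "fls_X_intpow n * x * r + fls_X_intpow n * y * s = fls_X_intpow n * (x * r + y * s)"
      by (simp only: distrib_left mult.assoc)
    then have "fls_X_intpow n * x * r + fls_X_intpow n * y * s = fls_X_intpow n"
      using rs by simp
    then show ?thesis
      by (simp add: vec_eq_iff forall_2 row_mult_nth w)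
  qed
  ultimately show ?thesis by blast
qed

text \<open>
  Reduction theory for \<open>\<F>\<^sub>q[t]\<close>. Choose \<open>\<gamma>\<close> such that the bottom row of \<open>\<gamma> g\<close> is as short as
  possible, and make \<open>\<gamma> g\<close> upper triangular by an element of \<open>SL\<^sub>2(\<O>)\<close>. A polynomial multiple of
  the bottom row removes the polynomial part of the corner entry. What is left of this entry is
  shorter than the bottom row, so if \<open>m\<close> were negative, the top row would be the shorter one. Hence
  \<open>m \<ge> 0\<close>, and then the unipotent part lies in \<open>SL\<^sub>2(\<O>)\<close>.
\<close>

lemma cartan_decomposition:
  assumes g: "det (g :: 'a::{field,finite} fls^2^2) = 1"
  shows "\<exists>\<gamma>\<in>SL2_poly. \<exists>m\<ge>0. \<exists>k\<in>SL2_int. g = \<gamma> ** cartan m ** k"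
proof -
  define B where "B = {n. \<exists>\<gamma>\<in>SL2_poly. \<gamma> $ 2 v* g \<in> vec_pideal n}"
  have B_hits: "n \<in> B \<Longrightarrow> hits (vec_pideal n) g" for n
    using SL2_poly_row_in_poly_rows by (auto simp: B_def hits_def)
  have B_down: "n \<in> B \<Longrightarrow> n' \<le> n \<Longrightarrow> n' \<in> B" for n n'
    using vec_pideal_antimono by (auto simp: B_def)
  obtain c where "\<forall>i j. g $ i $ j \<in> pideal c" using matrix_pideal_bound by blast
  then have "g $ 2 \<in> vec_pideal c" by (simp add: vec_pideal_def)
  then have "(mat 1 :: 'a fls^2^2) $ 2 v* g \<in> vec_pideal c"
    using row_of_mult[of "mat 1" g 2] by simp
  then have "c \<in> B" using mat_1_in_SL2_poly by (auto simp: B_def)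
  obtain N where "N \<notin> B" using hits_vec_pideal_bounded[OF g] B_hits by blast
  obtain n where n: "n \<in> B" "n + 1 \<notin> B"
  proof -
    have "c \<le> N" using B_down[of c N] \<open>c \<in> B\<close> \<open>N \<notin> B\<close> by linarith
    have "\<exists>n. n \<in> B \<and> n + 1 \<notin> B"
    proof (rule ccontr)
      assume *: "\<not> ?thesis"
      have "N \<in> B" using \<open>c \<le> N\<close> by (induct N rule: int_ge_induct) (use \<open>c \<in> B\<close> * in auto)
      with \<open>N \<notin> B\<close> show False by simp
    qed
    then show ?thesis using that by blast
  qed
  obtain \<gamma> where \<gamma>: "\<gamma> \<in> SL2_poly" "\<gamma> $ 2 v* g \<in> vec_pideal n" using n(1) by (auto simp: B_def)
  have "\<gamma> $ 2 v* g \<notin> vec_pideal (n + 1)" using n(2) \<gamma>(1) by (auto simp: B_def)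
  with \<gamma>(2) obtain k where k: "k \<in> SL2_int" "(\<gamma> $ 2 v* g) v* k = vector [0, fls_X_intpow n]"
    using unimodular_over_int_ring[of "\<gamma> $ 2 v* g" n] by (auto simp: vec_pideal_def pideal_succ_iff)
  define M where "M = \<gamma> ** g ** k"
  have "M $ 2 = vector [0, fls_X_intpow n]"
    using k(2) by (simp add: M_def row_of_mult)
  then have M2: "M $ 2 $ 1 = 0" "M $ 2 $ 2 = fls_X_intpow n" by simp_all
  have "det M = 1" using \<gamma>(1) k(1) g by (simp add: M_def det_mul SL2_poly_def SL2_int_def)
  then have "M $ 1 $ 1 * fls_X_intpow n = 1" by (simp add: det_2 M2)
  then have "fls_shift (- n) (M $ 1 $ 1) = 1"
    by (simp only: shift_one_mult)
  then have M1: "M $ 1 $ 1 = fls_X_intpow (- n)"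
    by (simp add: fls_shift_eq_1_iff)
  obtain r where r: "r \<in> poly_ring" "fls_shift n (M $ 1 $ 2) - r \<in> pideal 1"
    using poly_ring_plus_pideal by blast
  define b where "b = fls_shift n (M $ 1 $ 2) - r"
  have b: "b \<in> pideal 1" using r(2) by (simp add: b_def)
  define \<delta> where "\<delta> = mat2 1 (- r) 0 1 ** \<gamma>"
  have \<delta>: "\<delta> \<in> SL2_poly"
    unfolding \<delta>_def using r(1) \<gamma>(1) by (intro SL2_poly_mult mat2_in_SL2_poly) auto
  have "mat2 1 (- r) 0 1 ** M = mat2 (fls_X_intpow (- n)) (fls_X_intpow n * b) 0 (fls_X_intpow n)"
    by (intro mat2_eqI)
      (auto simp: mat_mult_nth M1 M2 b_def right_diff_distrib shift_one_mult mult.commute)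
  then have red: "\<delta> ** g ** k = mat2 (fls_X_intpow (- n)) (fls_X_intpow n * b) 0 (fls_X_intpow n)"
    by (simp add: \<delta>_def M_def matrix_mul_assoc)
  have kk: "k ** adj2 k = mat 1" "adj2 k \<in> SL2_int"
    using k(1) adj2_mult[of k] SL2_int_adj2 by (auto simp: SL2_int_def)
  have "n \<ge> 0"
  proof (rule ccontr)
    assume "\<not> n \<ge> 0"
    define \<sigma> where "\<sigma> = mat2 0 1 (- 1) 0 ** \<delta>"
    have "\<sigma> \<in> SL2_poly"
      unfolding \<sigma>_def using \<delta> by (intro SL2_poly_mult mat2_in_SL2_poly) auto
    have "\<sigma> $ 2 v* g = (\<sigma> ** g ** k ** adj2 k) $ 2"
      by (simp add: kk row_of_mult flip: matrix_mul_assoc)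
    also have "\<dots> = (mat2 0 1 (- 1) 0 ** (\<delta> ** g ** k)) $ 2 v* adj2 k"
      by (simp add: \<sigma>_def row_of_mult vector_matrix_mul_assoc matrix_mul_assoc)
    also have "\<dots> \<in> vec_pideal (n + 1)"
    proof (rule vec_pideal_int_mats)
      show "adj2 k \<in> int_mats" using kk by (simp add: SL2_int_def)
      show "(mat2 0 1 (- 1) 0 ** (\<delta> ** g ** k)) $ 2 \<in> vec_pideal (n + 1)"
        unfolding red using b \<open>\<not> n \<ge> 0\<close>
        by (simp add: vec_pideal_def mat_mult_nth shift_one_mult)
    qed
    finally have "n + 1 \<in> B" using \<open>\<sigma> \<in> SL2_poly\<close> by (auto simp: B_def)
    with n(2) show False by simp
  qed
  define l where "l = mat2 1 (fls_X_intpow (2 * n) * b) 0 1"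
  have "l \<in> SL2_int"
    unfolding l_def using b \<open>n \<ge> 0\<close>
    by (intro mat2_in_SL2_int) (auto simp: shift_one_mult elim: pideal_antimono)
  have "\<delta> ** g ** k = cartan n ** l"
    unfolding red by (intro mat2_eqI)
      (auto simp: mat_mult_nth cartan_def l_def shift_one_mult)
  moreover have "g = adj2 \<delta> ** (\<delta> ** g ** k) ** adj2 k"
  proof -
    have "adj2 \<delta> ** \<delta> = mat 1" using \<delta> adj2_mult by (auto simp: SL2_poly_def)
    then have "g = (adj2 \<delta> ** \<delta>) ** g ** (k ** adj2 k)" by (simp add: kk)
    then show ?thesis by (simp only: matrix_mul_assoc)
  qed
  ultimately have "g = adj2 \<delta> ** cartan n ** (l ** adj2 k)"
    by (simp only: matrix_mul_assoc)
  moreover have "l ** adj2 k \<in> SL2_int" using \<open>l \<in> SL2_int\<close> kk(2) by (rule SL2_int_mult)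
  ultimately show ?thesis using \<open>n \<ge> 0\<close> SL2_poly_adj2[OF \<delta>] by blast
qed

text \<open>
  The second row of a diagonal matrix is a shortest vector when the valuation of its entry is at
  least that of the other one.
\<close>

lemma hits_diag_iff:
  assumes "a \<noteq> 0" "fls_subdegree a \<le> s" "b \<noteq> 0" "fls_subdegree b = s"
  shows "hits (vec_pideal n) (mat2 a 0 0 b) \<longleftrightarrow> n \<le> s"
proof
  assume "n \<le> s"
  then have "vector [0, 1] v* mat2 a 0 0 b \<in> vec_pideal n"
    using assms by (simp add: row_mult_nth vec_pideal_def pideal_iff_subdegree)
  moreover have "vector [0, 1] \<in> poly_rows" by (simp add: poly_rows_def vec_2_eq_0_iff)
  ultimately show "hits (vec_pideal n) (mat2 a 0 0 b)" by (auto simp: hits_def)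
next
  assume "hits (vec_pideal n) (mat2 a 0 0 b)"
  then obtain v where v: "v \<in> poly_rows" "v $ 1 * a \<in> pideal n" "v $ 2 * b \<in> pideal n"
    by (auto simp: hits_def vec_pideal_def row_mult_nth)
  show "n \<le> s"
  proof (rule ccontr)
    assume "\<not> n \<le> s"
    then have "v $ 1 \<in> pideal 1"
      using v(2) assms by (cases "v $ 1 = 0") (auto simp: pideal_iff_subdegree)
    moreover have "v $ 2 \<in> pideal 1"
      using \<open>\<not> n \<le> s\<close> v(3) assms by (cases "v $ 2 = 0") (auto simp: pideal_iff_subdegree)
    ultimately have "v $ 1 = 0" "v $ 2 = 0"
      using v(1) poly_ring_inter_pideal by (auto simp: poly_rows_def)
    with v(1) show False by (simp add: poly_rows_def vec_2_eq_0_iff)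
  qed
qed

lemma hits_cartan_iff: "m \<ge> 0 \<Longrightarrow> hits (vec_pideal n) (cartan m) \<longleftrightarrow> n \<le> m"
  unfolding cartan_def by (rule hits_diag_iff) (auto simp: fls_shift_eq0_iff)

lemma hits_decomposed_iff:
  assumes "\<gamma> \<in> SL2_poly" "m \<ge> 0" "k \<in> SL2_int"
  shows "hits (vec_pideal n) (\<gamma> ** cartan m ** k) \<longleftrightarrow> n \<le> m"
  using assms SL2_poly_subset_GL2_poly
  by (auto simp: hits_SL2_int_iff hits_GL2_poly_iff hits_cartan_iff)

section \<open>The height in terms of short vectors\<close>

definition std_lattice :: "('a::{field,finite} fls^2) set" where
  "std_lattice = {x. \<forall>i. x $ i \<in> int_ring}"

lemma int_mats_std_lattice: "k \<in> int_mats \<Longrightarrow> x \<in> std_lattice \<Longrightarrow> k *v x \<in> std_lattice"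
proof -
  assume "k \<in> int_mats" "x \<in> std_lattice"
  then have "k $ i $ j * x $ j \<in> pideal 0" for i j
    using pideal_mult[of "k $ i $ j" 0 "x $ j" 0] by (auto simp: int_mats_def std_lattice_def int_ring_eq_pideal)
  then show ?thesis
    by (auto simp: std_lattice_def int_ring_eq_pideal mat_vec_nth intro!: pideal_add)
qed

lemma SL2_int_std_lattice:
  assumes "k \<in> SL2_int"
  shows "(*v) k ` std_lattice = std_lattice"
proof
  show "(*v) k ` std_lattice \<subseteq> std_lattice"
    using assms int_mats_std_lattice by (auto simp: SL2_int_def)
  show "std_lattice \<subseteq> (*v) k ` std_lattice"
  proof
    fix x :: "'a fls^2" assume "x \<in> std_lattice"
    moreover have "adj2 k \<in> int_mats" using SL2_int_adj2[OF assms] by (simp add: SL2_int_def)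
    ultimately have "adj2 k *v x \<in> std_lattice" using int_mats_std_lattice by blast
    moreover have "x = k *v (adj2 k *v x)"
      using assms adj2_mult[of k] by (simp add: SL2_int_def matrix_vector_mul_assoc)
    ultimately show "x \<in> (*v) k ` std_lattice" by blast
  qed
qed

text \<open>
  Inclusions of lattices become factorizations with an integral factor; this transports both
  the determinant and the lengths of row vectors between bases of the same lattice.
\<close>

lemma lattice_image_subset_imp_factor:
  fixes M M' :: "'a::{field,finite} fls^2^2"
  assumes "(*v) M ` std_lattice \<subseteq> (*v) M' ` std_lattice"
  shows "\<exists>N\<in>int_mats. M = M' ** N"
proof -
  have "vector [1, 0] \<in> std_lattice" "vector [0, 1] \<in> std_lattice"
    by (auto simp: std_lattice_def forall_2 int_ring_eq_pideal)
  then obtain x y where xy: "x \<in> std_lattice" "y \<in> std_lattice"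
      "M *v vector [1, 0] = M' *v x" "M *v vector [0, 1] = M' *v y"
    using assms by blast
  have cols: "M $ i $ 1 = (M' *v x) $ i" "M $ i $ 2 = (M' *v y) $ i" for i :: 2
    by (simp_all add: mat_vec_nth flip: xy(3,4))
  have "mat2 (x $ 1) (y $ 1) (x $ 2) (y $ 2) \<in> int_mats"
    using xy by (simp add: int_mats_def forall_2 std_lattice_def int_ring_eq_pideal)
  moreover have "M = M' ** mat2 (x $ 1) (y $ 1) (x $ 2) (y $ 2)"
    by (rule mat2_eqI) (simp_all add: cols mat_vec_nth mat_mult_nth)
  ultimately show ?thesis by blast
qed

lemma homothety_class_scale:
  assumes "c \<noteq> 0"
  shows "homothety_class ((*s) c ` L) = homothety_class L"
proof -
  have "(*s) d ` L \<in> homothety_class ((*s) c ` L)" if "d \<noteq> 0" for d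
  proof -
    have "(*s) d ` L = (*s) (d / c) ` (*s) c ` L"
      using assms by (simp add: image_image)
    moreover have "d / c \<noteq> 0" using that assms by simp
    ultimately show ?thesis unfolding homothety_class_def by blast
  qed
  moreover have "(*s) d ` (*s) c ` L \<in> homothety_class L" if "d \<noteq> 0" for d
  proof -
    have "(*s) d ` (*s) c ` L = (*s) (d * c) ` L" by (simp add: image_image)
    moreover have "d * c \<noteq> 0" using that assms by simp
    ultimately show ?thesis unfolding homothety_class_def by blast
  qed
  ultimately show ?thesis unfolding homothety_class_def by blast
qed

lemma vertex_act_base: "vertex_act g base_vertex = homothety_class ((*v) g ` std_lattice)"
  by (simp add: base_vertex_def vertex_act_homothety_class std_lattice_def)

lemma vertex_act_ray:
  "vertex_act g (ray_vertex n) = homothety_class ((*v) (g ** mat2 (fls_X_inv ^ n) 0 0 1) ` std_lattice)"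
  by (simp add: ray_vertex_def vertex_act_base vertex_act_homothety_class image_image
      matrix_vector_mul_assoc diag2_def mat2_def)

lemma GL2_poly_det_subdegree:
  assumes "g \<in> GL2_poly"
  shows "det g \<noteq> 0 \<and> fls_subdegree (det g) = 0"
proof -
  obtain h where h: "\<forall>i j. h $ i $ j \<in> poly_ring" "g ** h = mat 1"
    using assms by (auto simp: GL2_poly_def)
  have d: "det g * det h = 1" using h(2) by (metis det_I det_mul)
  have "det g \<in> poly_ring" "det h \<in> poly_ring"
    using assms h(1) by (auto simp: GL2_poly_def det_2 intro!: poly_ring_diff poly_ring_mult)
  moreover have nz: "det g \<noteq> 0" "det h \<noteq> 0" using d by auto
  ultimately have "fls_subdegree (det g) \<le> 0" "fls_subdegree (det h) \<le> 0"
    by (meson nth_fls_subdegree_nonzero not_le poly_ring_iff)+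
  moreover have "fls_subdegree (det g) + fls_subdegree (det h) = 0"
    using nz by (metis d fls_subdegree_mult fls_one_subdegree)
  ultimately show ?thesis using nz by simp
qed

text \<open>
  The vertex \<open>a\<^sub>m v\<^sub>0\<close> is \<open>v\<^sub>2\<^sub>m\<close>, since \<open>a\<^sub>m = t\<^sup>-\<^sup>m diag(t\<^sup>2\<^sup>m, 1)\<close>. For the uniqueness of the
  height, suppose that the lattices of \<open>g = \<gamma> a\<^sub>m k\<close> and of \<open>c h diag(t\<^sup>n, 1)\<close> agree. Their shortest row
  vectors have the same length, so \<open>c\<close> has valuation \<open>m\<close>; their determinants have the same
  valuation, so \<open>2 m - n = 0\<close>.
\<close>

lemma height_decomposed:
  fixes m :: nat and \<gamma> k :: "'a::{field,finite} fls^2^2"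
  assumes "\<gamma> \<in> SL2_poly" "k \<in> SL2_int"
  shows "height (vertex_act (\<gamma> ** cartan (int m) ** k) base_vertex) = 2 * m"
  unfolding height_def
proof (rule the_equality)
  let ?g = "\<gamma> ** cartan (int m) ** k"
  have "(*v) ?g ` std_lattice = (*v) (\<gamma> ** cartan (int m)) ` (*v) k ` std_lattice"
    by (simp add: image_image matrix_vector_mul_assoc)
  then have "(*v) ?g ` std_lattice = (*v) (\<gamma> ** cartan (int m)) ` std_lattice"
    by (simp only: SL2_int_std_lattice[OF assms(2)])
  moreover have "(*v) (\<gamma> ** mat2 (fls_X_inv ^ (2 * m)) 0 0 1) ` std_lattice =
      (*s) (fls_X_inv ^ m) ` (*v) (\<gamma> ** cartan (int m)) ` std_lattice"
  proof -
    have "(\<gamma> ** mat2 (fls_X_inv ^ (2 * m)) 0 0 1) *v x = fls_X_inv ^ m *s ((\<gamma> ** cartan (int m)) *v x)" for x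
    proof -
      have "mat2 (fls_X_inv ^ (2 * m)) 0 0 1 *v x = fls_X_inv ^ m *s (cartan (int m) *v x)"
        by (simp add: vec_eq_iff forall_2 mat_vec_nth cartan_def fls_X_inv_power_conv_shift_1
            shift_one_mult)
      then show ?thesis
        by (simp add: vec.scale flip: matrix_vector_mul_assoc)
    qed
    then show ?thesis by (simp add: image_image)
  qed
  ultimately have "vertex_act ?g base_vertex = vertex_act \<gamma> (ray_vertex (2 * m))"
    unfolding vertex_act_base vertex_act_ray by (simp add: homothety_class_scale)
  then show "\<exists>g\<in>GL2_poly. vertex_act ?g base_vertex = vertex_act g (ray_vertex (2 * m))"
    using assms(1) SL2_poly_subset_GL2_poly by blast
next
  let ?g = "\<gamma> ** cartan (int m) ** k"
  fix n assume "\<exists>h\<in>GL2_poly. vertex_act ?g base_vertex = vertex_act h (ray_vertex n)"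
  then obtain h where h: "h \<in> GL2_poly"
    and eq: "homothety_class ((*v) ?g ` std_lattice) =
      homothety_class ((*v) (h ** mat2 (fls_X_inv ^ n) 0 0 1) ` std_lattice)"
    by (auto simp: vertex_act_base vertex_act_ray)
  have "L \<in> homothety_class L" for L :: "('a fls^2) set"
    unfolding homothety_class_def by (intro CollectI exI[of _ 1] conjI) simp_all
  from this[of "(*v) ?g ` std_lattice"] have
    "(*v) ?g ` std_lattice \<in> homothety_class ((*v) (h ** mat2 (fls_X_inv ^ n) 0 0 1) ` std_lattice)"
    by (simp only: eq)
  then obtain c where c: "c \<noteq> 0"
    "(*v) ?g ` std_lattice = (*s) c ` (*v) (h ** mat2 (fls_X_inv ^ n) 0 0 1) ` std_lattice"
    unfolding homothety_class_def by blast
  \<comment> \<open>The homothety factor is absorbed into the diagonal matrix.\<close>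
  define D where "D = mat2 (c * fls_X_inv ^ n) 0 0 c"
  have "c *s ((h ** mat2 (fls_X_inv ^ n) 0 0 1) *v x) = (h ** D) *v x" for x
    by (simp add: vec_eq_iff forall_2 mat_vec_nth mat_mult_nth D_def algebra_simps)
  with c(2) have img: "(*v) ?g ` std_lattice = (*v) (h ** D) ` std_lattice"
    by (simp add: image_image)
  obtain N where N: "N \<in> int_mats" "?g = h ** D ** N"
    using lattice_image_subset_imp_factor[of ?g "h ** D"] img by auto
  obtain N' where N': "N' \<in> int_mats" "h ** D = ?g ** N'"
    using lattice_image_subset_imp_factor[of "h ** D" ?g] img by auto
  have "hits (vec_pideal i) ?g \<longleftrightarrow> hits (vec_pideal i) (h ** D)" for i
    using hits_int_mats[of i "h ** D" N] hits_int_mats[of i ?g N'] N(1) N'(1)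
    by (simp only: N(2)[symmetric] N'(2)[symmetric]) blast
  then have le_iff: "i \<le> int m \<longleftrightarrow> i \<le> fls_subdegree c" for i
    using hits_decomposed_iff[OF assms(1) _ assms(2), of "int m" i]
      hits_GL2_poly_iff[OF h, of "vec_pideal i" D] hits_diag_iff[of "c * fls_X_inv ^ n" "fls_subdegree c" c i] c(1)
    by (simp add: D_def)
  have m: "fls_subdegree c = int m"
    using le_iff[of "int m"] le_iff[of "fls_subdegree c"] by simp
  have "det ?g = 1"
    using assms by (simp add: det_mul SL2_poly_def SL2_int_def det_cartan)
  then have d: "det (h ** D) = det N'" "det (h ** D) * det N = 1"
    using arg_cong[OF N(2), of det] arg_cong[OF N'(2), of det]
    by (simp_all only: det_mul mult_1)
  have "det N \<in> pideal 0" "det N' \<in> pideal 0"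
    using N(1) N'(1) by (simp_all add: int_mats_det)
  moreover have nz: "det (h ** D) \<noteq> 0" "det N \<noteq> 0" using d by auto
  ultimately have "fls_subdegree (det (h ** D)) \<ge> 0" "fls_subdegree (det N) \<ge> 0"
    using d(1) by (auto simp: pideal_iff_subdegree)
  moreover have "fls_subdegree (det (h ** D)) + fls_subdegree (det N) = 0"
    using nz d(2) by (metis fls_subdegree_mult fls_one_subdegree)
  ultimately have "fls_subdegree (det (h ** D)) = 0" by simp
  moreover have "fls_subdegree (det (h ** D)) = 2 * int m - int n"
  proof -
    have "det D = c * fls_X_inv ^ n * c"
      by (simp add: D_def det_2)
    moreover have "fls_subdegree (c * fls_X_inv ^ n * c) = 2 * int m - int n"
      using c(1) m by simp
    ultimately show ?thesis
      using GL2_poly_det_subdegree[OF h] c(1) by (simp add: det_mul)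
  qed
  ultimately show "n = 2 * m" by simp
qed

text \<open>
  The height is \<open>2 m\<close> exactly when the shortest vectors of the row lattice have norm \<open>q\<^sup>-\<^sup>m\<close>.
\<close>

lemma height_eq_iff:
  assumes "det (g :: 'a::{field,finite} fls^2^2) = 1"
  shows "even (height (vertex_act g base_vertex))"
    and "height (vertex_act g base_vertex) = 2 * m \<longleftrightarrow>
      hits (vec_pideal (int m)) g \<and> \<not> hits (vec_pideal (int m + 1)) g"
proof -
  obtain \<gamma> n k where *: "\<gamma> \<in> SL2_poly" "n \<ge> 0" "k \<in> SL2_int" "g = \<gamma> ** cartan n ** k"
    using cartan_decomposition[OF assms] by blast
  then have h: "height (vertex_act g base_vertex) = 2 * nat n"
    using height_decomposed[of \<gamma> k "nat n"] by simp
  have hits: "hits (vec_pideal i) g \<longleftrightarrow> i \<le> n" for i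
    unfolding *(4) using * by (intro hits_decomposed_iff)
  show "even (height (vertex_act g base_vertex))" by (simp add: h)
  show "height (vertex_act g base_vertex) = 2 * m \<longleftrightarrow>
      hits (vec_pideal (int m)) g \<and> \<not> hits (vec_pideal (int m + 1)) g"
    unfolding h hits using *(2) by linarith
qed

section \<open>Splitting the level sets by the direction of the short vector\<close>

definition cone :: "int \<Rightarrow> int \<Rightarrow> ('a::{field,finite} fls^2) set" where
  "cone m e = {w. w $ 1 \<in> pideal m \<and> fls_nth (w $ 1) m \<noteq> 0 \<and> w $ 2 \<in> pideal (m + e)}"

definition level :: "int \<Rightarrow> 'a::{field,finite} fls^2^2 \<Rightarrow> bool" where
  "level m g \<longleftrightarrow> hits (vec_pideal m) g \<and> \<not> hits (vec_pideal (m + 1)) g"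

text \<open>
  The shortest vectors have norm \<open>q\<^sup>-\<^sup>m\<close>, and one of them agrees with the first coordinate
  axis up to \<open>\<pi>\<^sup>e\<close>; for \<open>e = 0\<close> this says that its first coordinate has full norm.
\<close>

definition aligned :: "int \<Rightarrow> int \<Rightarrow> 'a::{field,finite} fls^2^2 \<Rightarrow> bool" where
  "aligned m e g \<longleftrightarrow> hits (cone m e) g \<and> \<not> hits (vec_pideal (m + 1)) g"

definition unip :: "'a::{field,finite} fls \<Rightarrow> 'a fls^2^2" where
  "unip s = mat2 1 s 0 1"

definition weyl :: "'a::{field,finite} fls^2^2" where
  "weyl = mat2 0 1 (- 1) 0"

lemma pideal_cancel_left:
  assumes "x \<in> pideal m" "fls_nth x m \<noteq> 0" "x * y \<in> pideal (m + n)"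
  shows "y \<in> pideal n"
proof (cases "y = 0")
  case False
  have "x \<noteq> 0" "fls_subdegree x = m"
    using assms(1,2) by (auto simp: pideal_def intro!: fls_subdegree_eqI)
  then show ?thesis using assms(3) False by (simp add: pideal_iff_subdegree)
qed simp

text \<open>
  Two vectors of the row lattice span a parallelogram whose area is a polynomial in \<open>t\<close>, as
  \<open>det g = 1\<close>. If the area is in \<open>\<pi> \<O>\<close>, the two vectors are parallel.
\<close>

lemma cross2_poly_rows_eq_0:
  assumes "v \<in> poly_rows" "v' \<in> poly_rows" "det g = 1" "w = v v* g" "w' = v' v* g"
    "w $ 1 * w' $ 2 - w $ 2 * w' $ 1 \<in> pideal n" "n \<ge> 1"
  shows "w $ 1 * w' $ 2 = w $ 2 * w' $ 1"
proof -
  have "w $ 1 * w' $ 2 - w $ 2 * w' $ 1 = cross2 v v'"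
    using cross2_row_mult[of v g v'] assms(3-5) by (simp add: cross2_def)
  moreover have "cross2 v v' \<in> poly_ring"
    using assms(1,2) by (auto simp: cross2_def poly_rows_def intro!: poly_ring_diff poly_ring_mult)
  ultimately have "w $ 1 * w' $ 2 - w $ 2 * w' $ 1 = 0"
    using poly_ring_inter_pideal assms(6,7) by metis
  then show ?thesis by simp
qed

lemma unip_in_SL2_int: "s \<in> pideal 0 \<Longrightarrow> unip s \<in> SL2_int"
  unfolding unip_def by (intro mat2_in_SL2_int) auto

lemma row_mult_unip: "(w v* unip s) $ 1 = w $ 1" "(w v* unip s) $ 2 = w $ 2 + s * w $ 1"
  by (simp_all add: row_mult_nth unip_def algebra_simps)

lemma weyl_in_SL2_int: "weyl \<in> SL2_int"
  unfolding weyl_def by (intro mat2_in_SL2_int) auto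

lemma row_mult_weyl: "(w v* weyl) $ 1 = - w $ 2" "(w v* weyl) $ 2 = w $ 1"
  by (simp_all add: row_mult_nth weyl_def)

text \<open>
  The monomial \<open>c \<pi>\<^sup>e\<close>.
\<close>

abbreviation digit :: "'a::{field,finite} \<Rightarrow> int \<Rightarrow> 'a fls" where
  "digit c e \<equiv> fls_shift (- e) (fls_const c)"

lemma digit_in_pideal: "digit c e \<in> pideal e"
  by simp

lemma digit_mult_nth:
  assumes "x \<in> pideal m"
  shows "digit c e * x \<in> pideal (m + e)" "fls_nth (digit c e * x) (m + e) = c * fls_nth x m"
  using pideal_mult[OF digit_in_pideal assms, of e c] pideal_mult_nth[OF digit_in_pideal assms, of e c]
  by (simp_all add: add.commute)

text \<open>
  For a vector \<open>(x, y)\<close> in the cone, exactly one digit \<open>c\<close> makes the leading coefficient of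
  \<open>y + c \<pi>\<^sup>e x\<close> vanish, and the unipotent element lies in \<open>SL\<^sub>2(\<O>)\<close>, so it keeps all lengths.
\<close>

lemma aligned_iff_ex_digit:
  assumes "e \<ge> 0"
  shows "aligned m e g \<longleftrightarrow> (\<exists>c. aligned m (e + 1) (g ** unip (digit c e)))"
proof -
  have u: "unip (digit c e) \<in> SL2_int" for c :: 'a
    using assms by (intro unip_in_SL2_int) simp
  have "hits (cone m e) g \<longleftrightarrow> (\<exists>c. hits (cone m (e + 1)) (g ** unip (digit c e)))"
  proof
    assume "hits (cone m e) g"
    then obtain v where v: "v \<in> poly_rows" "v v* g \<in> cone m e" by (auto simp: hits_def)
    define w where "w = v v* g"
    define c where "c = - fls_nth (w $ 2) (m + e) / fls_nth (w $ 1) m"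
    have w: "w $ 1 \<in> pideal m" "fls_nth (w $ 1) m \<noteq> 0" "w $ 2 \<in> pideal (m + e)"
      using v(2) by (auto simp: cone_def w_def)
    have "w $ 2 + digit c e * w $ 1 \<in> pideal (m + e)"
      using w by (intro pideal_add digit_mult_nth)
    moreover have "fls_nth (w $ 2 + digit c e * w $ 1) (m + e) = 0"
      using w by (simp only: fls_plus_nth digit_mult_nth) (simp add: c_def)
    ultimately have "w $ 2 + digit c e * w $ 1 \<in> pideal (m + e + 1)"
      by (simp only: pideal_succ_iff)
    then have "w v* unip (digit c e) \<in> cone m (e + 1)"
      using w by (simp add: cone_def row_mult_unip add.assoc)
    then show "\<exists>c. hits (cone m (e + 1)) (g ** unip (digit c e))"
      using v(1) by (auto simp: hits_def w_def vector_matrix_mul_assoc)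
  next
    assume "\<exists>c. hits (cone m (e + 1)) (g ** unip (digit c e))"
    then obtain c v where v: "v \<in> poly_rows" "(v v* g) v* unip (digit c e) \<in> cone m (e + 1)"
      by (auto simp: hits_def vector_matrix_mul_assoc)
    define w where "w = v v* g"
    have w: "w $ 1 \<in> pideal m" "fls_nth (w $ 1) m \<noteq> 0"
        "w $ 2 + digit c e * w $ 1 \<in> pideal (m + (e + 1))"
      using v(2) by (auto simp: cone_def w_def row_mult_unip)
    have "(w $ 2 + digit c e * w $ 1) - digit c e * w $ 1 \<in> pideal (m + e)"
      using w by (intro pideal_diff digit_mult_nth) (auto elim: pideal_antimono)
    then have "w \<in> cone m e" using w by (simp add: cone_def)
    then show "hits (cone m e) g" using v(1) by (auto simp: hits_def w_def)
  qed
  then show ?thesis using hits_SL2_int_iff[OF u] by (simp add: aligned_def)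
qed

text \<open>
  Two digits could come from two different short vectors \<open>(x, y)\<close> and \<open>(x', y')\<close>. Both are so close
  to the axis that \<open>x y' - y x'\<close> lies in \<open>\<pi>\<^bsup>2 m + e\<^esup> \<O>\<close>; by the bound on \<open>2 m + e\<close> they are then
  parallel and require the same digit.
\<close>

lemma aligned_digit_unique:
  assumes g: "det g = 1" and e: "2 * m + e \<ge> 1" "e \<ge> 0"
    and c: "aligned m (e + 1) (g ** unip (digit c e))" and c': "aligned m (e + 1) (g ** unip (digit c' e))"
  shows "c = c'"
proof -
  obtain v where v: "v \<in> poly_rows" "(v v* g) v* unip (digit c e) \<in> cone m (e + 1)"
    using c by (auto simp: aligned_def hits_def vector_matrix_mul_assoc)
  obtain v' where v': "v' \<in> poly_rows" "(v' v* g) v* unip (digit c' e) \<in> cone m (e + 1)"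
    using c' by (auto simp: aligned_def hits_def vector_matrix_mul_assoc)
  define x y x' y' where "x = (v v* g) $ 1" "y = (v v* g) $ 2" "x' = (v' v* g) $ 1" "y' = (v' v* g) $ 2"
  note xy_def = this
  have x: "x \<in> pideal m" "fls_nth x m \<noteq> 0" "y + digit c e * x \<in> pideal (m + e + 1)"
    using v(2) by (auto simp: cone_def xy_def row_mult_unip add.assoc)
  have x': "x' \<in> pideal m" "fls_nth x' m \<noteq> 0" "y' + digit c' e * x' \<in> pideal (m + e + 1)"
    using v'(2) by (auto simp: cone_def xy_def row_mult_unip add.assoc)
  have "(y + digit c e * x) - digit c e * x \<in> pideal (m + e)"
    "(y' + digit c' e * x') - digit c' e * x' \<in> pideal (m + e)"
    using x x' by (intro pideal_diff digit_mult_nth; auto elim: pideal_antimono)+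
  then have y: "y \<in> pideal (m + e)" "y' \<in> pideal (m + e)" by simp_all
  have "x * y' - y * x' \<in> pideal (2 * m + e)"
    using pideal_mult[OF x(1) y(2)] pideal_mult[OF y(1) x'(1)]
    by (intro pideal_diff) (simp_all add: algebra_simps)
  then have eq: "x * y' = y * x'"
    using cross2_poly_rows_eq_0[OF v(1) v'(1) g refl refl] e(1) by (simp add: xy_def)
  have "digit c' e - digit c e = digit (c' - c) e"
    by (simp add: fls_eq_iff)
  then have "x * (y' + digit c' e * x') - (y + digit c e * x) * x' = digit (c' - c) e * (x * x')"
    using eq by (metis (no_types, opaque_lifting) add_diff_cancel_left' diff_diff_eq2 add_diff_eq distrib_left distrib_right left_diff_distrib
       mult.assoc mult.left_commute)
  moreover have "x * (y' + digit c' e * x') - (y + digit c e * x) * x' \<in> pideal (m + m + e + 1)"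
    using pideal_mult[OF x(1) x'(3)] pideal_mult[OF x(3) x'(1)]
    by (intro pideal_diff) (simp_all add: algebra_simps)
  ultimately have "fls_nth (digit (c' - c) e * (x * x')) (m + m + e) = 0"
    by (simp only: pideal_succ_iff)
  then have "(c' - c) * (fls_nth x m * fls_nth x' m) = 0"
    using x x' by (simp only: digit_mult_nth[OF pideal_mult] pideal_mult_nth)
  then show ?thesis using x(2) x'(2) by simp
qed

lemma row_mult_cartan: "(w v* cartan (- 1)) $ 1 = fls_shift (- 1) (w $ 1)" "(w v* cartan (- 1)) $ 2 = fls_shift 1 (w $ 2)"
  by (simp_all add: row_mult_nth cartan_def shift_one_mult)

text \<open>
  The matrix \<open>diag(\<pi>, \<pi>\<^sup>-\<^sup>1)\<close> shrinks a short vector that agrees with the first axis up to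
  \<open>\<pi>\<^sup>2\<close>, and leaves it in the cone around the axis. A vector that is shorter than this image comes
  from a shorter one before, and conversely a shorter vector before is parallel to the
  short one, so it shrinks in the same way.
\<close>

lemma aligned_climb:
  assumes g: "det g = 1" and "m \<ge> 0"
  shows "aligned (m + 1) 0 (g ** cartan (- 1)) \<longleftrightarrow> aligned m 2 g"
proof -
  have cone: "w v* cartan (- 1) \<in> cone (m + 1) 0 \<longleftrightarrow> w \<in> cone m 2" for w :: "'a fls^2"
    by (simp add: cone_def row_mult_cartan add.assoc)
  have ball: "w v* cartan (- 1) \<in> vec_pideal (m + 2) \<longleftrightarrow> w $ 1 \<in> pideal (m + 1) \<and> w $ 2 \<in> pideal (m + 3)"
    for w :: "'a fls^2"
    by (simp add: vec_pideal_def row_mult_cartan ac_simps)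
  have "hits (cone (m + 1) 0) (g ** cartan (- 1)) \<longleftrightarrow> hits (cone m 2) g"
    by (simp add: hits_def cone flip: vector_matrix_mul_assoc)
  moreover have "hits (vec_pideal (m + 2)) (g ** cartan (- 1)) \<longleftrightarrow> hits (vec_pideal (m + 1)) g"
    if "hits (cone m 2) g"
  proof -
    obtain v where v: "v \<in> poly_rows" "v v* g \<in> cone m 2" using \<open>hits (cone m 2) g\<close> by (auto simp: hits_def)
    define w where "w = v v* g"
    have w: "w $ 1 \<in> pideal m" "fls_nth (w $ 1) m \<noteq> 0" "w $ 2 \<in> pideal (m + 2)"
      using v(2) by (auto simp: cone_def w_def)
    have "(v' v* g) $ 2 \<in> pideal (m + 3)" if v': "v' \<in> poly_rows" "v' v* g \<in> vec_pideal (m + 1)" for v'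
    proof -
      define w' where "w' = v' v* g"
      have w': "w' $ 1 \<in> pideal (m + 1)" "w' $ 2 \<in> pideal (m + 1)"
        using v'(2) by (auto simp: vec_pideal_def w'_def)
      have "w $ 1 * w' $ 2 \<in> pideal (2 * m + 1)" "w $ 2 * w' $ 1 \<in> pideal (2 * m + 1)"
        using pideal_mult[OF w(1) w'(2)] pideal_mult[OF w(3) w'(1)]
        by (auto elim!: pideal_antimono)
      then have eq: "w $ 1 * w' $ 2 = w $ 2 * w' $ 1"
        using \<open>m \<ge> 0\<close> by (intro cross2_poly_rows_eq_0[OF v(1) v'(1) g w_def w'_def] pideal_diff) auto
      have "w $ 1 * w' $ 2 \<in> pideal (m + (m + 3))"
        using pideal_mult[OF w(3) w'(1)] unfolding eq by (simp add: algebra_simps)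
      then show ?thesis
        using pideal_cancel_left[OF w(1,2)] by (simp add: w'_def)
    qed
    then have "(v' v* g) v* cartan (- 1) \<in> vec_pideal (m + 2) \<longleftrightarrow> v' v* g \<in> vec_pideal (m + 1)"
      if "v' \<in> poly_rows" for v'
      using that pideal_antimono[of "(v' v* g) $ 2" "m + 3" "m + 1"]
      unfolding ball by (auto simp: vec_pideal_def)
    then show ?thesis
      by (simp add: hits_def flip: vector_matrix_mul_assoc)
  qed
  ultimately show ?thesis by (auto simp: aligned_def add.assoc)
qed

lemma cone_subset_vec_pideal: "e \<ge> 0 \<Longrightarrow> cone m e \<subseteq> vec_pideal m"
  by (auto simp: cone_def vec_pideal_def elim: pideal_antimono)

text \<open>
  At height \<open>0\<close> the row lattice is \<open>\<F>\<^sub>q[t]\<^sup>2 k\<close> with \<open>k\<close> in \<open>SL\<^sub>2(\<O>)\<close>, and the constant rows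
  realize all directions modulo \<open>\<pi>\<close>. The row \<open>v\<close> below is the first row of the inverse of
  \<open>k\<close> modulo \<open>\<pi>\<close>.
\<close>

lemma level_0_iff_aligned:
  assumes g: "det (g :: 'a::{field,finite} fls^2^2) = 1"
  shows "level 0 g \<longleftrightarrow> aligned 0 1 g"
proof
  assume "aligned 0 1 g"
  then show "level 0 g" using cone_subset_vec_pideal[of 1 0] by (auto simp: aligned_def level_def hits_def)
next
  assume lev: "level 0 g"
  obtain \<gamma> n k where *: "\<gamma> \<in> SL2_poly" "n \<ge> 0" "k \<in> SL2_int" "g = \<gamma> ** cartan n ** k"
    using cartan_decomposition[OF g] by blast
  then have "n = 0" using lev hits_decomposed_iff[OF *(1-3), of 1] by (simp add: level_def)
  moreover have "cartan 0 = (mat 1 :: 'a fls^2^2)" by (rule mat2_eqI) (simp_all add: cartan_def mat_def)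
  ultimately have "g = \<gamma> ** k" using *(4) by (simp only: matrix_mul_rid)
  define v :: "'a fls^2" where
    "v = vector [fls_const (fls_nth (k $ 2 $ 2) 0), - fls_const (fls_nth (k $ 1 $ 2) 0)]"
  have k: "k $ i $ j \<in> pideal 0" for i j using *(3) by (simp add: SL2_int_def int_mats_def)
  have nth: "fls_nth (k $ i $ j * k $ i' $ j') 0 = fls_nth (k $ i $ j) 0 * fls_nth (k $ i' $ j') 0" for i j i' j'
    using pideal_mult_nth[OF k k, of i j i' j'] by simp
  have "fls_nth (det k) 0 = 1" using *(3) by (simp add: SL2_int_def)
  then have "fls_nth (k $ 1 $ 1) 0 * fls_nth (k $ 2 $ 2) 0 - fls_nth (k $ 1 $ 2) 0 * fls_nth (k $ 2 $ 1) 0 = 1"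
    by (simp add: det_2 nth)
  then have "fls_nth ((v v* k) $ 1) 0 = 1" "fls_nth ((v v* k) $ 2) 0 = 0"
    by (simp_all add: row_mult_nth v_def mult.commute)
  moreover have "v v* k \<in> vec_pideal 0"
    using *(3) by (intro vec_pideal_int_mats) (auto simp: SL2_int_def v_def vec_pideal_def)
  ultimately have cone: "v v* k \<in> cone 0 1"
    using pideal_succ_iff[of "(v v* k) $ 2" 0] by (simp add: cone_def vec_pideal_def)
  have "v \<noteq> 0" using \<open>fls_nth ((v v* k) $ 1) 0 = 1\<close> by auto
  then have "v \<in> poly_rows" by (simp add: poly_rows_def v_def)
  with cone have "hits (cone 0 1) k" by (auto simp: hits_def)
  moreover have "\<gamma> \<in> GL2_poly" using *(1) SL2_poly_subset_GL2_poly by blast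
  ultimately have "hits (cone 0 1) g"
    unfolding \<open>g = \<gamma> ** k\<close> by (simp add: hits_GL2_poly_iff)
  then show "aligned 0 1 g" using lev by (simp add: aligned_def level_def)
qed

text \<open>
  Modulo \<open>\<pi>\<close>, the first coordinate of the rescaled short vector either survives or vanishes; in the
  second case the Weyl element turns the vector towards the first axis.
\<close>

lemma level_iff_aligned:
  "level m g \<longleftrightarrow> aligned m 0 g \<or> aligned m 1 (g ** weyl)"
proof -
  have "w \<in> vec_pideal m \<longleftrightarrow> w \<in> cone m 0 \<or> w v* weyl \<in> cone m 1 \<or> w \<in> vec_pideal (m + 1)" for w :: "'a fls^2"
    by (auto simp: cone_def vec_pideal_def row_mult_weyl pideal_succ_iff)
  then have "hits (vec_pideal m) g \<longleftrightarrow>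
      hits (cone m 0) g \<or> hits (cone m 1) (g ** weyl) \<or> hits (vec_pideal (m + 1)) g"
    by (auto simp: hits_def simp flip: vector_matrix_mul_assoc)
  then show ?thesis
    using hits_SL2_int_iff[OF weyl_in_SL2_int] by (auto simp: level_def aligned_def)
qed

text \<open>
  Two short vectors with different directions modulo \<open>\<pi>\<close> span an area of norm \<open>q\<^sup>-\<^sup>2\<^sup>m\<close>, which is not
  the norm of a polynomial when \<open>m \<ge> 1\<close>.
\<close>

lemma aligned_weyl_disjoint:
  assumes g: "det g = 1" and "m \<ge> 1" and c: "aligned m 0 g" "aligned m 1 (g ** weyl)"
  shows False
proof -
  obtain v where v: "v \<in> poly_rows" "v v* g \<in> cone m 0"
    using c(1) by (auto simp: aligned_def hits_def)
  obtain v' where v': "v' \<in> poly_rows" "(v' v* g) v* weyl \<in> cone m 1"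
    using c(2) by (auto simp: aligned_def hits_def vector_matrix_mul_assoc)
  define w w' where "w = v v* g" "w' = v' v* g"
  note w_def = this
  have w: "w $ 1 \<in> pideal m" "fls_nth (w $ 1) m \<noteq> 0" "w $ 2 \<in> pideal m"
    using v(2) by (auto simp: cone_def w_def)
  have w': "w' $ 2 \<in> pideal m" "fls_nth (w' $ 2) m \<noteq> 0" "w' $ 1 \<in> pideal (m + 1)"
    using v'(2) by (auto simp: cone_def w_def row_mult_weyl)
  have p: "w $ 1 * w' $ 2 \<in> pideal (m + m)" "w $ 2 * w' $ 1 \<in> pideal (m + m + 1)"
    using pideal_mult[OF w(1) w'(1)] pideal_mult[OF w(3) w'(3)] by (auto simp: add.assoc)
  have "w $ 1 * w' $ 2 = w $ 2 * w' $ 1"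
    using p \<open>m \<ge> 1\<close>
    by (intro cross2_poly_rows_eq_0[OF v(1) v'(1) g w_def, of "m + m"] pideal_diff)
      (auto elim: pideal_antimono)
  then have "fls_nth (w $ 1 * w' $ 2) (m + m) = 0"
    using p(2) by (simp only: pideal_succ_iff)
  then show False using w(2) w'(2) by (simp only: pideal_mult_nth[OF w(1) w'(1)]) simp
qed

section \<open>Open conditions on the row lattice\<close>

definition mat_ball :: "'a::{field,finite} fls^2^2 \<Rightarrow> int \<Rightarrow> ('a fls^2^2) set" where
  "mat_ball g n = {h. \<forall>i j. h $ i $ j - g $ i $ j \<in> pideal n}"

lemma open_pideal_coset: "open {f. f - a \<in> pideal n}"
  unfolding open_fls_def
proof
  fix f assume f: "f \<in> {f. f - a \<in> pideal n}"
  have "y - a \<in> pideal n" if "dist y f < inverse (2 ^ nat n)" for y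
  proof -
    have "y - f \<in> pideal n"
    proof (cases "y = f")
      case False
      have "fls_subdegree (y - f) \<ge> 0"
      proof (rule ccontr)
        assume neg: "\<not> ?thesis"
        then have "dist y f = 2 ^ nat (- fls_subdegree (y - f))"
          using False by (simp add: dist_fls_def)
        then have "dist y f \<ge> 1" by simp
        moreover have "inverse (2 ^ nat n :: real) \<le> 1" by (simp add: inverse_le_1_iff)
        ultimately show False using that by linarith
      qed
      then have "inverse (2 ^ nat (fls_subdegree (y - f)) :: real) < inverse (2 ^ nat n)"
        using False that by (simp add: dist_fls_def)
      then have "nat n < nat (fls_subdegree (y - f))" by simp
      then show ?thesis by (simp add: pideal_iff_subdegree)
    qed simp
    then have "(y - f) + (f - a) \<in> pideal n" using f by (intro pideal_add) auto
    then show ?thesis by simp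
  qed
  then show "\<exists>r>0. {y. dist y f < r} \<subseteq> {f. f - a \<in> pideal n}"
    by (intro exI[of _ "inverse (2 ^ nat n)"]) auto
qed

lemma open_mat_ball: "open (mat_ball g n)"
proof -
  have "mat_ball g n = (\<Inter>i. \<Inter>j. (\<lambda>h. h $ i) -` ((\<lambda>r. r $ j) -` {f. f - g $ i $ j \<in> pideal n}))"
    by (auto simp: mat_ball_def)
  also have "open \<dots>"
    by (intro open_INT ballI open_vimage_vec_nth open_pideal_coset) auto
  finally show ?thesis .
qed

lemma mat_ball_self: "g \<in> mat_ball g n"
  by (simp add: mat_ball_def)

text \<open>
  Openness in \<open>F\<^sup>2\<close> in terms of congruences, the form in which it passes to matrices.
\<close>

definition padic_open :: "('a::{field,finite} fls^2) set \<Rightarrow> bool" where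
  "padic_open W \<longleftrightarrow> (\<forall>w\<in>W. \<exists>n. \<forall>w'. w' - w \<in> vec_pideal n \<longrightarrow> w' \<in> W)"

lemma padic_open_vec_pideal: "padic_open (vec_pideal m)"
  unfolding padic_open_def
proof (intro ballI exI allI impI)
  fix w w' :: "'a fls^2" assume "w \<in> vec_pideal m" "w' - w \<in> vec_pideal m"
  then have "w $ i + (w' $ i - w $ i) \<in> pideal m" if "i = 1 \<or> i = 2" for i
    using that by (intro pideal_add) (auto simp: vec_pideal_def)
  then show "w' \<in> vec_pideal m" by (simp add: vec_pideal_def)
qed

lemma padic_open_cone: "padic_open (cone m e)"
  unfolding padic_open_def
proof (intro ballI exI allI impI)
  fix w w' :: "'a fls^2"
  assume w: "w \<in> cone m e" and "w' - w \<in> vec_pideal (max (m + 1) (m + e))"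
  then have d: "w' $ 1 - w $ 1 \<in> pideal (m + 1)" "w' $ 2 - w $ 2 \<in> pideal (m + e)"
    by (auto simp: vec_pideal_def elim: pideal_antimono)
  have "w $ 1 + (w' $ 1 - w $ 1) \<in> pideal m" "w $ 2 + (w' $ 2 - w $ 2) \<in> pideal (m + e)"
    using d w by (intro pideal_add; auto simp: cone_def elim: pideal_antimono)+
  then show "w' \<in> cone m e"
    using d(1) w by (simp add: cone_def pideal_succ_iff)
qed

lemma padic_open_preimage:
  assumes "padic_open W"
  shows "padic_open {w. w v* h \<in> W}"
  unfolding padic_open_def
proof
  fix w assume "w \<in> {w. w v* h \<in> W}"
  then obtain n where n: "\<And>w'. w' - w v* h \<in> vec_pideal n \<Longrightarrow> w' \<in> W"
    using assms by (auto simp: padic_open_def)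
  obtain c where c: "\<And>w k. w \<in> vec_pideal k \<Longrightarrow> w v* h \<in> vec_pideal (k + c)"
    using row_mult_pideal_bound[of h] by blast
  have "w' v* h \<in> W" if "w' - w \<in> vec_pideal (n - c)" for w'
    using c[OF that] by (intro n) (simp add: vector_matrix_mult_diff_distrib)
  then show "\<exists>n. \<forall>w'. w' - w \<in> vec_pideal n \<longrightarrow> w' \<in> {w. w v* h \<in> W}" by blast
qed

text \<open>
  The witness \<open>v\<close> stays fixed while \<open>v g\<close> varies continuously with \<open>g\<close>.
\<close>

lemma hits_locally_constant:
  assumes "padic_open W" "hits W g"
  shows "\<exists>n. \<forall>h\<in>mat_ball g n. hits W h"
proof -
  obtain v where v: "v \<in> poly_rows" "v v* g \<in> W" using assms(2) by (auto simp: hits_def)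
  obtain n where n: "\<And>w'. w' - v v* g \<in> vec_pideal n \<Longrightarrow> w' \<in> W"
    using assms(1) v(2) by (auto simp: padic_open_def)
  obtain c1 c2 where "v $ 1 \<in> pideal c1" "v $ 2 \<in> pideal c2" using in_some_pideal by metis
  then have c: "v $ 1 \<in> pideal (min c1 c2)" "v $ 2 \<in> pideal (min c1 c2)"
    by (auto elim: pideal_antimono)
  have "hits W h" if "h \<in> mat_ball g (n - min c1 c2)" for h
  proof -
    have "v $ i * (h $ i $ j - g $ i $ j) \<in> pideal n" if "i = 1 \<or> i = 2" for i j
      using pideal_mult[of "v $ i" "min c1 c2" "h $ i $ j - g $ i $ j" "n - min c1 c2"]
        c that \<open>h \<in> _\<close> by (auto simp: mat_ball_def)
    then have "v $ 1 * (h $ 1 $ j - g $ 1 $ j) + v $ 2 * (h $ 2 $ j - g $ 2 $ j) \<in> pideal n" for j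
      by (intro pideal_add) auto
    then have "v v* h - v v* g \<in> vec_pideal n"
      by (simp add: vec_pideal_def row_mult_nth algebra_simps)
    then show ?thesis using n v(1) by (auto simp: hits_def)
  qed
  then show ?thesis by blast
qed

section \<open>Measurable sets of cosets\<close>

text \<open>
  A set of cosets given by a condition on representatives. The condition can be read off from the
  coset when it is invariant under \<open>\<Gamma>\<close>.
\<close>

definition cosets_where :: "('a::{field,finite} fls^2^2 \<Rightarrow> bool) \<Rightarrow> ('a fls^2^2) set set" where
  "cosets_where P = {SL2_poly #>\<^bsub>SL2F\<^esub> g | g. det g = 1 \<and> P g}"

definition left_invariant :: "('a::{field,finite} fls^2^2 \<Rightarrow> bool) \<Rightarrow> bool" where
  "left_invariant P \<longleftrightarrow> (\<forall>\<gamma>\<in>SL2_poly. \<forall>g. P (\<gamma> ** g) \<longleftrightarrow> P g)"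

lemma coset_eq: "SL2_poly #>\<^bsub>SL2F\<^esub> g = {\<gamma> ** g | \<gamma>. \<gamma> \<in> SL2_poly}"
  by (auto simp: r_coset_def SL2F_def)

lemma carrier_SL2F [simp]: "g \<in> carrier SL2F \<longleftrightarrow> det g = 1"
  by (simp add: SL2F_def)

lemma coset_self: "g \<in> SL2_poly #>\<^bsub>SL2F\<^esub> g"
  unfolding coset_eq using mat_1_in_SL2_poly by (force intro: exI[of _ "mat 1"])

lemma coset_translate:
  "(SL2_poly #>\<^bsub>SL2F\<^esub> g) #>\<^bsub>SL2F\<^esub> h = SL2_poly #>\<^bsub>SL2F\<^esub> (g ** h)"
  by (auto simp: r_coset_def SL2F_def matrix_mul_assoc)

lemma quot_X_eq_cosets_where: "quot_X = cosets_where (\<lambda>_. True)"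
  by (auto simp: quot_X_def RCOSETS_def cosets_where_def)

lemma in_cosets_where_iff:
  assumes "left_invariant P" "det g = 1"
  shows "SL2_poly #>\<^bsub>SL2F\<^esub> g \<in> cosets_where P \<longleftrightarrow> P g"
proof
  assume "SL2_poly #>\<^bsub>SL2F\<^esub> g \<in> cosets_where P"
  then obtain g' where g': "P g'" "SL2_poly #>\<^bsub>SL2F\<^esub> g = SL2_poly #>\<^bsub>SL2F\<^esub> g'"
    by (auto simp: cosets_where_def)
  with coset_self[of g] obtain \<gamma> where "\<gamma> \<in> SL2_poly" "g = \<gamma> ** g'" by (auto simp: coset_eq)
  with g'(1) assms(1) show "P g" by (auto simp: left_invariant_def)
qed (use assms in \<open>auto simp: cosets_where_def\<close>)

lemma cosets_where_mono: "(\<And>g. det g = 1 \<Longrightarrow> P g \<Longrightarrow> Q g) \<Longrightarrow> cosets_where P \<subseteq> cosets_where Q"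
  by (auto simp: cosets_where_def)

lemma cosets_where_cong: "(\<And>g. det g = 1 \<Longrightarrow> P g \<longleftrightarrow> Q g) \<Longrightarrow> cosets_where P = cosets_where Q"
  by (auto simp: cosets_where_def)

lemma cosets_where_subset_quot_X: "cosets_where P \<subseteq> quot_X"
  unfolding quot_X_eq_cosets_where by (rule cosets_where_mono) simp

lemma cosets_where_Ex: "cosets_where (\<lambda>g. \<exists>i\<in>I. P i g) = (\<Union>i\<in>I. cosets_where (P i))"
  by (auto simp: cosets_where_def)

lemma cosets_where_disjoint:
  assumes "left_invariant P" "\<And>g. det g = 1 \<Longrightarrow> P g \<Longrightarrow> Q g \<Longrightarrow> False"
  shows "cosets_where P \<inter> cosets_where Q = {}"
proof -
  have False if "SL2_poly #>\<^bsub>SL2F\<^esub> g \<in> cosets_where P" "det g = 1" "Q g" for g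
    using in_cosets_where_iff[OF assms(1) that(2)] that assms(2) by blast
  then show ?thesis by (auto simp: cosets_where_def)
qed

lemma cosets_where_Diff:
  assumes "left_invariant Q"
  shows "cosets_where (\<lambda>g. P g \<and> \<not> Q g) = cosets_where P - cosets_where Q"
proof -
  have "SL2_poly #>\<^bsub>SL2F\<^esub> g \<in> cosets_where Q \<longleftrightarrow> Q g" if "det g = 1" for g
    using in_cosets_where_iff[OF assms that] .
  then show ?thesis by (fastforce simp: cosets_where_def)
qed

lemma cosets_where_translate:
  assumes "left_invariant P" "det h = 1"
  shows "(\<lambda>x. x #>\<^bsub>SL2F\<^esub> h) -` cosets_where P \<inter> quot_X = cosets_where (\<lambda>g. P (g ** h))"
proof -
  have "(SL2_poly #>\<^bsub>SL2F\<^esub> g) #>\<^bsub>SL2F\<^esub> h \<in> cosets_where P \<longleftrightarrow> P (g ** h)" if "det g = 1" for g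
    using in_cosets_where_iff[OF assms(1), of "g ** h"] that assms(2)
    by (simp add: coset_translate det_mul)
  then show ?thesis by (auto simp: quot_X_eq_cosets_where cosets_where_def)
qed

lemma left_invariant_hits: "left_invariant (hits W)"
  using hits_GL2_poly_iff SL2_poly_subset_GL2_poly unfolding left_invariant_def by blast

lemma left_invariant_level: "left_invariant (level m)"
  unfolding left_invariant_def level_def
  by (simp add: left_invariant_hits[unfolded left_invariant_def])

lemma left_invariant_aligned: "left_invariant (aligned m e)"
  unfolding left_invariant_def aligned_def
  by (simp add: left_invariant_hits[unfolded left_invariant_def])

lemma left_invariant_translate: "left_invariant P \<Longrightarrow> left_invariant (\<lambda>g. P (g ** h))"
  unfolding left_invariant_def by (simp flip: matrix_mul_assoc)

lemma space_borel_X: "space borel_X = quot_X"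
  unfolding borel_X_def by (rule space_measure_of) auto

lemma cosets_where_hits_measurable:
  assumes "padic_open W"
  shows "cosets_where (hits W) \<in> sets borel_X"
proof -
  let ?G = "{U. U \<subseteq> quot_X \<and>
     openin (top_of_set (carrier SL2F)) {g \<in> carrier SL2F. SL2_poly #>\<^bsub>SL2F\<^esub> g \<in> U}}"
  obtain n where n: "\<And>g h. hits W g \<Longrightarrow> h \<in> mat_ball g (n g) \<Longrightarrow> hits W h"
    using hits_locally_constant[OF assms] by metis
  define T where "T = (\<Union>g\<in>Collect (hits W). mat_ball g (n g))"
  have "open T" unfolding T_def by (intro open_UN ballI open_mat_ball)
  have "T = Collect (hits W)"
  proof
    show "T \<subseteq> Collect (hits W)" unfolding T_def using n by blast
    show "Collect (hits W) \<subseteq> T"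
      unfolding T_def by (blast intro: mat_ball_self)
  qed
  then have "{g \<in> carrier SL2F. SL2_poly #>\<^bsub>SL2F\<^esub> g \<in> cosets_where (hits W)} = carrier SL2F \<inter> T"
    using in_cosets_where_iff[OF left_invariant_hits] by auto
  then have "cosets_where (hits W) \<in> ?G"
    using \<open>open T\<close> cosets_where_subset_quot_X by (auto simp: openin_open)
  moreover have "?G \<subseteq> Pow quot_X" by blast
  ultimately show ?thesis unfolding borel_X_def by (intro in_measure_of)
qed

lemma hits_translate: "hits W (g ** h) \<longleftrightarrow> hits {w. w v* h \<in> W} g"
  by (simp add: hits_def vector_matrix_mul_assoc)

lemma cosets_where_aligned_measurable: "cosets_where (\<lambda>g. aligned m e (g ** h)) \<in> sets borel_X"
  unfolding aligned_def hits_translate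
  by (subst cosets_where_Diff[OF left_invariant_hits])
    (intro sets.Diff cosets_where_hits_measurable padic_open_preimage padic_open_cone padic_open_vec_pideal)

lemma cosets_where_level_measurable: "cosets_where (level m) \<in> sets borel_X"
  unfolding level_def
  by (subst cosets_where_Diff[OF left_invariant_hits])
    (intro sets.Diff cosets_where_hits_measurable padic_open_vec_pideal)

lemma level_iff_height:
  "det g = 1 \<Longrightarrow> level (int m) g \<longleftrightarrow> height (vertex_act g base_vertex) = 2 * m"
  by (simp add: height_eq_iff level_def)

lemma quot_X_eq_levels: "(quot_X :: ('a::{field,finite} fls^2^2) set set) = (\<Union>m. cosets_where (level (int m)))"
proof -
  have "\<exists>m. level (int m) g" if "det g = 1" for g :: "'a fls^2^2"
    using level_iff_height[OF that] height_eq_iff(1)[OF that] by (metis evenE)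
  then have "cosets_where (\<lambda>_. True) = cosets_where (\<lambda>g :: 'a fls^2^2. \<exists>m\<in>UNIV. level (int m) g)"
    by (intro cosets_where_cong) simp
  then show ?thesis by (simp only: quot_X_eq_cosets_where cosets_where_Ex)
qed

lemma disjoint_levels: "disjoint_family (\<lambda>m. cosets_where (level (int m)))"
  unfolding disjoint_family_on_def
  by (auto intro!: cosets_where_disjoint left_invariant_level simp: level_iff_height)

section \<open>Consequences of invariance\<close>

text \<open>
  The push-forward along a translation is by definition zero unless the formula for the measure of
  preimages is a measure on the Borel sets. The push-forward equals \<open>\<mu>\<close>, which has mass \<open>1\<close>, so the
  formula is valid.
\<close>

lemma invariant_emeasure:
  assumes "invariant_prob_X \<mu>" "det h = 1" "A \<in> sets borel_X"
  shows "emeasure \<mu> ((\<lambda>x. x #>\<^bsub>SL2F\<^esub> h) -` A \<inter> quot_X) = emeasure \<mu> A"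
proof -
  interpret prob_space \<mu> using assms(1) by (simp add: invariant_prob_X_def)
  have sets: "sets \<mu> = sets borel_X" using assms(1) by (simp add: invariant_prob_X_def)
  then have space: "space \<mu> = quot_X" using sets_eq_imp_space_eq space_borel_X by metis
  let ?f = "\<lambda>A. emeasure \<mu> ((\<lambda>x. x #>\<^bsub>SL2F\<^esub> h) -` A \<inter> space \<mu>)"
  have distr: "measure_of (space borel_X) (sets borel_X) ?f = \<mu>"
    using assms(1,2) by (simp add: invariant_prob_X_def distr_def)
  have conv: "emeasure \<mu> B = (if B \<in> sets borel_X \<and> measure_space (space borel_X) (sets borel_X) ?f
      then ?f B else 0)" for B
    by (subst (1) distr[symmetric]) (simp add: emeasure_measure_of_conv sets.sigma_sets_eq)
  have "emeasure \<mu> (space \<mu>) \<noteq> 0" by (simp add: emeasure_space_1)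
  then have "measure_space (space borel_X) (sets borel_X) ?f"
    using conv[of "space \<mu>"] by presburger
  then show ?thesis using conv[of A] assms(3) by (simp add: space)
qed

context
  fixes \<mu> :: "('a::{field,finite} fls^2^2) set measure"
  assumes inv: "invariant_prob_X \<mu>"
begin

lemma prob_mu: "prob_space \<mu>" and sets_mu: "sets \<mu> = sets borel_X"
  using inv by (simp_all add: invariant_prob_X_def)

lemma space_mu: "space \<mu> = quot_X"
  using sets_eq_imp_space_eq[OF sets_mu] space_borel_X by simp

lemma measure_aligned_translate:
  assumes "det h = 1"
  shows "measure \<mu> (cosets_where (\<lambda>g. aligned m e (g ** h))) = measure \<mu> (cosets_where (aligned m e))"
proof -
  have "cosets_where (aligned m e) \<in> sets borel_X"
    using cosets_where_aligned_measurable[of m e "mat 1"] by simp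
  from invariant_emeasure[OF inv assms this]
  show ?thesis
    by (simp add: cosets_where_translate[OF left_invariant_aligned assms] measure_def)
qed

text \<open>
  The \<open>q\<close> digits cut the set into translates of the same smaller set.
\<close>

lemma measure_aligned_refine:
  assumes "2 * m + e \<ge> 1" "e \<ge> 0"
  shows "measure \<mu> (cosets_where (aligned m e)) = real CARD('a) * measure \<mu> (cosets_where (aligned m (e + 1)))"
proof -
  interpret prob_space \<mu> by (rule prob_mu)
  let ?P = "\<lambda>c g. aligned m (e + 1) (g ** unip (digit c e))"
  have "cosets_where (aligned m e) = cosets_where (\<lambda>g :: 'a fls^2^2. \<exists>c\<in>UNIV. ?P c g)"
    by (intro cosets_where_cong) (simp add: aligned_iff_ex_digit[OF assms(2)])
  also have "\<dots> = (\<Union>c. cosets_where (?P c))"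
    by (rule cosets_where_Ex)
  finally have "measure \<mu> (cosets_where (aligned m e)) = measure \<mu> (\<Union>c. cosets_where (?P c))"
    by (rule arg_cong)
  also have "\<dots> = (\<Sum>c\<in>UNIV. measure \<mu> (cosets_where (?P c)))"
  proof (rule finite_measure_finite_Union)
    show "(\<lambda>c. cosets_where (?P c)) ` UNIV \<subseteq> sets \<mu>"
      using cosets_where_aligned_measurable by (auto simp: sets_mu)
    show "disjoint_family_on (\<lambda>c. cosets_where (?P c)) UNIV"
      unfolding disjoint_family_on_def
      using aligned_digit_unique[OF _ assms]
      by (auto intro!: cosets_where_disjoint left_invariant_translate left_invariant_aligned)
  qed simp
  also have "\<dots> = (\<Sum>c\<in>(UNIV :: 'a set). measure \<mu> (cosets_where (aligned m (e + 1))))"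
    by (intro sum.cong refl measure_aligned_translate) (simp add: unip_def det_2)
  finally show ?thesis by simp
qed

lemma measure_aligned_climb:
  assumes "m \<ge> 0"
  shows "measure \<mu> (cosets_where (aligned (m + 1) 0)) = measure \<mu> (cosets_where (aligned m 2))"
proof -
  have "cosets_where (aligned m 2) = cosets_where (\<lambda>g :: 'a fls^2^2. aligned (m + 1) 0 (g ** cartan (- 1)))"
    by (intro cosets_where_cong) (simp add: aligned_climb[OF _ assms])
  then show ?thesis by (simp add: measure_aligned_translate det_cartan)
qed

lemma measure_aligned_step:
  assumes "m \<ge> 1"
  shows "measure \<mu> (cosets_where (aligned m 0)) = (real CARD('a))\<^sup>2 * measure \<mu> (cosets_where (aligned (m + 1) 0))"
  using measure_aligned_refine[of m 0] measure_aligned_refine[of m 1] measure_aligned_climb[of m] assms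
  by (simp add: power2_eq_square)

lemma measure_level_0:
  "measure \<mu> (cosets_where (level 0)) = real CARD('a) * measure \<mu> (cosets_where (aligned 1 0))"
proof -
  have "cosets_where (level 0) = cosets_where (aligned 0 1 :: 'a fls^2^2 \<Rightarrow> bool)"
    by (intro cosets_where_cong level_0_iff_aligned)
  then show ?thesis
    using measure_aligned_refine[of 0 1] measure_aligned_climb[of 0] by simp
qed

text \<open>
  For \<open>m \<ge> 1\<close> the direction modulo \<open>\<pi>\<close> of the short vector is a point of the projective line
  over \<open>\<F>\<^sub>q\<close>. The cone covers its \<open>q\<close> affine points and the Weyl translate covers the remaining one.
\<close>

lemma measure_level_pos:
  assumes "m \<ge> 1"
  shows "real CARD('a) * measure \<mu> (cosets_where (level m)) = (real CARD('a) + 1) * measure \<mu> (cosets_where (aligned m 0))"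
proof -
  interpret prob_space \<mu> by (rule prob_mu)
  have "cosets_where (level m) = cosets_where (aligned m 0) \<union> cosets_where (\<lambda>g :: 'a fls^2^2. aligned m 1 (g ** weyl))"
    by (auto simp: cosets_where_def level_iff_aligned)
  moreover have "cosets_where (aligned m 0) \<inter> cosets_where (\<lambda>g :: 'a fls^2^2. aligned m 1 (g ** weyl)) = {}"
    by (intro cosets_where_disjoint left_invariant_aligned) (rule aligned_weyl_disjoint[OF _ assms])
  moreover have "cosets_where (aligned m 0) \<in> sets \<mu>" "cosets_where (\<lambda>g. aligned m 1 (g ** weyl)) \<in> sets \<mu>"
    using cosets_where_aligned_measurable[of m 0 "mat 1"] cosets_where_aligned_measurable[of m 1 weyl]
    by (simp_all add: sets_mu)
  ultimately have "measure \<mu> (cosets_where (level m)) =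
      measure \<mu> (cosets_where (aligned m 0)) + measure \<mu> (cosets_where (\<lambda>g. aligned m 1 (g ** weyl)))"
    by (simp add: finite_measure_Union)
  also have "measure \<mu> (cosets_where (\<lambda>g. aligned m 1 (g ** weyl))) = measure \<mu> (cosets_where (aligned m 1))"
    by (intro measure_aligned_translate) (simp add: weyl_def det_2)
  finally show ?thesis
    using measure_aligned_refine[of m 0] assms by (simp add: algebra_simps)
qed

lemma measure_aligned_eq:
  "measure \<mu> (cosets_where (aligned (int n + 1) 0)) = measure \<mu> (cosets_where (aligned 1 0)) * (1 / (real CARD('a))\<^sup>2) ^ n"
proof (induction n)
  case (Suc n)
  then show ?case using measure_aligned_step[of "int n + 1"] by (simp add: field_simps)
qed simp

lemma measure_level_sums: "(\<lambda>m. measure \<mu> (cosets_where (level (int m)))) sums 1"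
proof -
  interpret prob_space \<mu> by (rule prob_mu)
  have "(\<lambda>m. measure \<mu> (cosets_where (level (int m)))) sums measure \<mu> (\<Union>m. cosets_where (level (int m)))"
    using cosets_where_level_measurable disjoint_levels
    by (intro finite_measure_UNION) (auto simp: sets_mu)
  moreover have "measure \<mu> (\<Union>m. cosets_where (level (int m))) = 1"
    using prob_space by (simp only: space_mu quot_X_eq_levels)
  ultimately show ?thesis by simp
qed

text \<open>
  All levels are multiples of one unknown \<open>p\<close>, namely \<open>q p\<close> at height \<open>0\<close> and
  \<open>(q + 1) p / q\<^sup>2\<^sup>m\<^sup>-\<^sup>1\<close> at height \<open>2 m\<close>; the total mass \<open>1\<close> forces \<open>p = (q - 1) / q\<^sup>2\<close>.
\<close>

lemma measure_level_eq:
  shows "measure \<mu> (cosets_where (level 0)) = (real CARD('a) - 1) / real CARD('a)"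
    and "m \<ge> 1 \<Longrightarrow> measure \<mu> (cosets_where (level (int m))) =
      ((real CARD('a))\<^sup>2 - 1) * real CARD('a) powi (- 2 * int m - 1)"
proof -
  define q where "q = real CARD('a)"
  define p where "p = measure \<mu> (cosets_where (aligned 1 0))"
  have "card {0, 1 :: 'a} \<le> CARD('a)" by (intro card_mono) auto
  then have q: "q > 1" by (simp add: q_def)
  then have q2: "q\<^sup>2 > 1" by (simp add: one_less_power)
  have level_0: "measure \<mu> (cosets_where (level 0)) = q * p"
    by (simp add: measure_level_0 p_def q_def)
  have level_Suc: "measure \<mu> (cosets_where (level (int (Suc n)))) = (q + 1) / q * p * (1 / q\<^sup>2) ^ n" for n
  proof -
    have "q * measure \<mu> (cosets_where (level (int (Suc n)))) = (q + 1) * (p * (1 / q\<^sup>2) ^ n)"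
      using measure_level_pos[of "int n + 1"] measure_aligned_eq[of n]
      by (simp add: p_def q_def add.commute)
    then show ?thesis using q by (simp add: field_simps)
  qed
  have "(\<lambda>n. (q + 1) / q * p * (1 / q\<^sup>2) ^ n) sums ((q + 1) / q * p * (1 / (1 - 1 / q\<^sup>2)))"
    using q2 by (intro sums_mult geometric_sums) (simp add: divide_less_eq)
  then have "(\<lambda>n. measure \<mu> (cosets_where (level (int n)))) sums ((q + 1) / q * p * (1 / (1 - 1 / q\<^sup>2)) + q * p)"
    unfolding level_Suc[symmetric] by (subst (asm) sums_Suc_iff) (simp add: level_0)
  then have total: "(q + 1) / q * p * (1 / (1 - 1 / q\<^sup>2)) + q * p = 1"
    using measure_level_sums sums_unique2 by blast
  have "(q + 1) / q * p * (1 / (1 - 1 / q\<^sup>2)) = p * (q / (q - 1))"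
  proof -
    have "1 - 1 / q\<^sup>2 = (q + 1) * (q - 1) / q\<^sup>2"
      using q by (simp add: field_simps power2_eq_square)
    then show ?thesis using q by (simp add: power2_eq_square)
  qed
  with total have "p * (q / (q - 1) + q) = 1" by (simp add: algebra_simps)
  moreover have "q / (q - 1) + q = q\<^sup>2 / (q - 1)"
    using q by (simp add: field_simps power2_eq_square)
  ultimately have p: "p = (q - 1) / q\<^sup>2"
    using q by (simp add: field_simps)
  show "measure \<mu> (cosets_where (level 0)) = (real CARD('a) - 1) / real CARD('a)"
    using q by (simp add: level_0 p power2_eq_square flip: q_def)
  assume "m \<ge> 1"
  then obtain n where n: "m = Suc n" by (cases m) auto
  have "q powi (- 2 * int m - 1) = inverse (q ^ (2 * n + 3))"
  proof -
    have "- 2 * int m - 1 = - int (2 * n + 3)" by (simp add: n)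
    then show ?thesis by (simp only: power_int_minus power_int_of_nat)
  qed
  moreover have "(1 / q\<^sup>2) ^ n = inverse (q ^ (2 * n))"
    by (simp add: power_mult power_one_over inverse_eq_divide)
  ultimately have "measure \<mu> (cosets_where (level (int m))) = (q\<^sup>2 - 1) * q powi (- 2 * int m - 1)"
    using q by (simp only: n level_Suc p) (simp add: field_simps power_add power2_eq_square power3_eq_cube)
  then show "measure \<mu> (cosets_where (level (int m))) =
      ((real CARD('a))\<^sup>2 - 1) * real CARD('a) powi (- 2 * int m - 1)"
    by (simp only: q_def)
qed

end

section \<open>The distribution of the spherical height\<close>

lemma spherical_height_coset:
  assumes "det g = 1"
  shows "spherical_height (SL2_poly #>\<^bsub>SL2F\<^esub> g) = height (vertex_act g base_vertex)"
proof -
  obtain m where m: "height (vertex_act g base_vertex) = 2 * m"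
    using height_eq_iff(1)[OF assms] by (metis evenE)
  then have lev: "level (int m) g" using assms by (simp add: level_iff_height)
  have "height (vertex_act h base_vertex) = 2 * m" if h: "h \<in> SL2_poly #>\<^bsub>SL2F\<^esub> g" for h
  proof -
    obtain \<gamma> where \<gamma>: "\<gamma> \<in> SL2_poly" "h = \<gamma> ** g" using h by (auto simp: coset_eq)
    then have "level (int m) h" using lev left_invariant_level by (auto simp: left_invariant_def)
    moreover have "det h = 1" using \<gamma> assms by (simp add: det_mul SL2_poly_def)
    ultimately show ?thesis by (simp add: level_iff_height)
  qed
  then have "(\<lambda>h. height (vertex_act h base_vertex)) ` (SL2_poly #>\<^bsub>SL2F\<^esub> g) = {2 * m}"
    using coset_self[of g] by auto
  then show ?thesis by (simp add: spherical_height_def m)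
qed

lemma spherical_height_vimage:
  "spherical_height -` {2 * m} \<inter> quot_X = cosets_where (level (int m))"
  by (auto simp: quot_X_eq_cosets_where cosets_where_def spherical_height_coset level_iff_height)

theorem proposition2p5:
  fixes \<mu> :: "('a::{field,finite} fls^2^2) set measure"
  assumes "invariant_prob_X \<mu>"
  defines "q \<equiv> real CARD('a)"
  shows "spherical_height \<in> \<mu> \<rightarrow>\<^sub>M count_space {n. even n} \<and>
    measure (rho_ev \<mu>) {0} = (q - 1) / q \<and>
    (\<forall>m::nat. m \<ge> 1 \<longrightarrow>
       measure (rho_ev \<mu>) {2 * m} = (q\<^sup>2 - 1) * q powi (- 2 * int m - 1))"
proof -
  note space = space_mu[OF assms(1)] and sets = sets_mu[OF assms(1)]
  have meas: "spherical_height \<in> \<mu> \<rightarrow>\<^sub>M count_space {n. even n}"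
  proof (subst measurable_count_space_eq_countable, safe)
    fix x assume "x \<in> space \<mu>"
    then show "even (spherical_height x)"
      by (auto simp: space quot_X_eq_cosets_where cosets_where_def spherical_height_coset height_eq_iff(1))
  next
    fix n :: nat assume "even n"
    then obtain m where "n = 2 * m" by (elim evenE)
    then show "spherical_height -` {n} \<inter> space \<mu> \<in> sets \<mu>"
      using cosets_where_level_measurable by (simp add: space sets spherical_height_vimage)
  qed simp
  have rho: "measure (rho_ev \<mu>) {2 * m} = measure \<mu> (cosets_where (level (int m)))" for m
    unfolding rho_ev_def
    by (subst measure_distr[OF meas]) (simp_all add: space spherical_height_vimage)
  show ?thesis
    using meas rho[of 0] rho measure_level_eq[OF assms(1)] by (auto simp: q_def)
qed

end
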